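(* Let $d\ge 1$ and $m\ge d$. Let $G=(V,E)$ be a graph, and let $V_1,\ldots,V_m$ be a partition of $V$ into nonempty sets. Assume that the reduced graph $G'$ of $G$ associated with this partition is $d$-rigid, and that for every $1\le i\le m$ and every pair of distinct vertices $u,v\in V_i$, there are at least $d$ distinct indices $j\in[m]$ such that $u$ and $v$ lie in the same connected component of $G[V_i,V_j]$. Then $G$ is $d$-rigid.
   Context: For $A,B\subseteq V$, $G[A,B]$ is the graph on vertex set $A\cup B$ whose edges are the edges $e$ of $G$ with $e\cap A\ne\varnothing$, $e\cap B\ne\varnothing$ and $e\subseteq A\cup B$ (so $G[A,A]$ is the induced subgraph $G[A]$, and for disjoint $A,B$ it is the bipartite graph of edges between $A$ and $B$). The reduced graph associated with the partition $V_1,\dots,V_m$ is $G'=([m],E')$ where $\{i,j\}\in E'$ iff $G$ has an edge with one endpoint in $V_i$ and the other in $V_j$. A $d$-dimensional framework $(G,\mathbf{p})$ is rigid if every continuous edge-length-preserving motion of the vertices starting at $\mathbf{p}$ preserves all pairwise distances; $\mathbf{p}$ is generic if its coordinates are algebraically independent over $\mathbb{Q}$; a graph is $d$-rigid if $(G,\mathbf{p})$ is rigid for some (equivalently, every) generic $\mathbf{p}:V\to\mathbb{R}^d$. *)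

theory Defs
  imports "HOL-Analysis.Analysis" "HOL-Library.Poly_Mapping" "HOL-Library.Disjoint_Sets"
begin

text \<open>Graphs are pairs (vertex set, edge set), edges being two-element sets of vertices.\<close>

type_synonym 'a ugraph = "'a set \<times> 'a set set"

abbreviation uverts :: "'a ugraph \<Rightarrow> 'a set" where "uverts \<equiv> fst"
abbreviation uedges :: "'a ugraph \<Rightarrow> 'a set set" where "uedges \<equiv> snd"

definition finite_simple_graph :: "'a ugraph \<Rightarrow> bool" where
  "finite_simple_graph G \<longleftrightarrow>
     finite (uverts G) \<and> (\<forall>e\<in>uedges G. e \<subseteq> uverts G \<and> card e = 2)"

definition edges_between_graph :: "'a ugraph \<Rightarrow> 'a set \<Rightarrow> 'a set \<Rightarrow> 'a ugraph" where
  "edges_between_graph G A B =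
     (A \<union> B, {e \<in> uedges G. e \<inter> A \<noteq> {} \<and> e \<inter> B \<noteq> {} \<and> e \<subseteq> A \<union> B})"

definition same_component :: "'a ugraph \<Rightarrow> 'a \<Rightarrow> 'a \<Rightarrow> bool" where
  "same_component G u v \<longleftrightarrow>
     u \<in> uverts G \<and> v \<in> uverts G \<and> (u, v) \<in> {(x, y). {x, y} \<in> uedges G}\<^sup>*"

text \<open>The condition \<open>i \<noteq> j\<close> keeps the reduced graph loopless: edges of \<open>G\<close> inside a part
  contribute nothing.\<close>

definition reduced_graph :: "'a ugraph \<Rightarrow> (nat \<Rightarrow> 'a set) \<Rightarrow> nat \<Rightarrow> nat ugraph" where
  "reduced_graph G Vs m =
     ({1..m}, {{i, j} | i j. i \<in> {1..m} \<and> j \<in> {1..m} \<and> i \<noteq> j \<and>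
                             (\<exists>u\<in>Vs i. \<exists>v\<in>Vs j. {u, v} \<in> uedges G)})"

text \<open>A multivariate polynomial with rational coefficients and variables indexed by \<open>'i\<close> is a
  finitely supported map from monomials (finitely supported exponent vectors) to the rationals.\<close>

definition rat_mpoly_eval :: "('i \<Rightarrow> real) \<Rightarrow> (('i \<Rightarrow>\<^sub>0 nat) \<Rightarrow>\<^sub>0 rat) \<Rightarrow> real" where
  "rat_mpoly_eval x P =
     (\<Sum>mon\<in>Poly_Mapping.keys P. of_rat (Poly_Mapping.lookup P mon) *
        (\<Prod>i\<in>Poly_Mapping.keys mon. x i ^ Poly_Mapping.lookup mon i))"

text \<open>Independence is that of the family \<open>(x i)\<^sub>i\<^sub>\<in>\<^sub>I\<close>, so in particular \<open>x\<close> is injective on \<open>I\<close>.\<close>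

definition alg_independent_over_rat :: "'i set \<Rightarrow> ('i \<Rightarrow> real) \<Rightarrow> bool" where
  "alg_independent_over_rat I x \<longleftrightarrow>
     (\<forall>P. (\<forall>mon\<in>Poly_Mapping.keys P. Poly_Mapping.keys mon \<subseteq> I) \<longrightarrow>
          rat_mpoly_eval x P = 0 \<longrightarrow> P = 0)"

definition generic_on :: "'a set \<Rightarrow> ('a \<Rightarrow> real ^ 'd) \<Rightarrow> bool" where
  "generic_on V p \<longleftrightarrow> alg_independent_over_rat (V \<times> (UNIV :: 'd set)) (\<lambda>(v, k). p v $ k)"

definition motion :: "'a ugraph \<Rightarrow> ('a \<Rightarrow> real ^ 'd) \<Rightarrow> (real \<Rightarrow> 'a \<Rightarrow> real ^ 'd) \<Rightarrow> bool" where
  "motion G p q \<longleftrightarrow>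
     (\<forall>v\<in>uverts G. continuous_on {0..1} (\<lambda>t. q t v)) \<and>
     (\<forall>v\<in>uverts G. q 0 v = p v) \<and>
     (\<forall>t\<in>{0..1}. \<forall>u v. {u, v} \<in> uedges G \<longrightarrow> dist (q t u) (q t v) = dist (p u) (p v))"

definition rigid :: "'a ugraph \<Rightarrow> ('a \<Rightarrow> real ^ 'd) \<Rightarrow> bool" where
  "rigid G p \<longleftrightarrow>
     (\<forall>q. motion G p q \<longrightarrow>
        (\<forall>t\<in>{0..1}. \<forall>u\<in>uverts G. \<forall>v\<in>uverts G. dist (q t u) (q t v) = dist (p u) (p v)))"

text \<open>The dimension \<open>d\<close> is \<open>CARD('d)\<close>, with \<open>'d\<close> passed as a type argument because it does not
  occur in the type of the graph.\<close>

definition d_rigid :: "'d::finite itself \<Rightarrow> 'a ugraph \<Rightarrow> bool" where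
  "d_rigid d G \<longleftrightarrow> (\<exists>p :: 'a \<Rightarrow> real ^ 'd. generic_on (uverts G) p \<and> rigid G p)"

end

theory Submission
  imports Defs "HOL-Computational_Algebra.Polynomial"
begin

text \<open>
  Everything is reduced to infinitesimal rigidity, the statement that the rows of the rigidity matrix
  together with the trivial infinitesimal motions have no common orthogonal vector. Fraction-free
  Gram--Schmidt shows that such a full-rank condition is the nonvanishing of a function \<open>N\<close> built from
  inner products of rows by ring operations; hence it passes from any special configuration to every
  generic one (\<open>N\<close> polynomial), and from a limit of configurations to nearby ones (\<open>N\<close> continuous).

  Collapse every part \<open>Vs i\<close> to the \<open>i\<close>-th point of a generic placement of the reduced graph, along a
  generic line. In the limit, the velocities of two vertices in a common part differ by a vector
  orthogonal to \<open>d\<close> independent directions, so a motion is constant on the parts and descends to the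
  reduced graph, where it is trivial.

  Generic rigidity and infinitesimal rigidity are compared through the identity
  \<open>|a|\<^sup>2 - |b|\<^sup>2 = (a - b) \<bullet> (a + b)\<close>: the difference of two placements preserves the edge lengths iff
  it is an infinitesimal motion of their midpoint. Given a nontrivial polynomial field \<open>X\<close> of
  infinitesimal motions, the solutions of \<open>m = x + s X(m)\<close> thus yield the exact flex \<open>2 m - x\<close>, with
  no differential equation or implicit function theorem.
\<close>

section \<open>Fraction-free Gram--Schmidt orthogonalization\<close>

definition ip :: "'i set \<Rightarrow> ('i \<Rightarrow> real) \<Rightarrow> ('i \<Rightarrow> real) \<Rightarrow> real" where
  "ip I a b = (\<Sum>i\<in>I. a i * b i)"

lemma ip_commute: "ip I a b = ip I b a"
  by (simp add: ip_def mult.commute)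

lemma ip_diff_left: "ip I (\<lambda>i. a i - b i) c = ip I a c - ip I b c"
  by (simp add: ip_def left_diff_distrib sum_subtractf)

lemma ip_add_left: "ip I (\<lambda>i. a i + b i) c = ip I a c + ip I b c"
  by (simp add: ip_def distrib_right sum.distrib)

lemma ip_scale_left: "ip I (\<lambda>i. t * a i) c = t * ip I a c"
  by (simp add: ip_def sum_distrib_left mult.assoc)

lemma ip_sum_left: "ip I (\<lambda>i. \<Sum>j\<in>J. f j i) c = (\<Sum>j\<in>J. ip I (f j) c)"
  unfolding ip_def sum_distrib_right by (rule sum.swap)

lemma ip_comb_left: "ip I (\<lambda>i. \<Sum>j\<in>J. t j * f j i) c = (\<Sum>j\<in>J. t j * ip I (f j) c)"
  by (simp add: ip_sum_left ip_scale_left)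

lemma ip_comb_right: "ip I c (\<lambda>i. \<Sum>j\<in>J. t j * f j i) = (\<Sum>j\<in>J. t j * ip I c (f j))"
  by (simp add: ip_commute[of I c] ip_comb_left)

lemma ip_cong: "(\<And>i. i \<in> I \<Longrightarrow> a i = a' i) \<Longrightarrow> (\<And>i. i \<in> I \<Longrightarrow> b i = b' i) \<Longrightarrow> ip I a b = ip I a' b'"
  by (simp add: ip_def)

lemma ip_self_nonneg: "0 \<le> ip I a a"
  by (simp add: ip_def sum_nonneg)

lemma ip_self_eq_0_iff: "finite I \<Longrightarrow> ip I a a = 0 \<longleftrightarrow> (\<forall>i\<in>I. a i = 0)"
  by (simp add: ip_def sum_nonneg_eq_0_iff)

lemma ip_unit: "finite I \<Longrightarrow> i \<in> I \<Longrightarrow> ip I (\<lambda>j. if j = i then 1 else 0) v = v i"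
  by (simp add: ip_def if_distrib[of "\<lambda>c. c * _"] cong: if_cong)

text \<open>One Gram--Schmidt argument serves several rings: rational polynomials, those depending
  only on distances, continuous functions of a real variable, and all functions on a point. Since
  only ring operations are available, denominators have to be cleared throughout.\<close>

definition fun_ring :: "('x \<Rightarrow> real) set \<Rightarrow> bool" where
  "fun_ring F \<longleftrightarrow> (\<lambda>_. 0) \<in> F \<and> (\<lambda>_. 1) \<in> F \<and>
     (\<forall>f\<in>F. \<forall>g\<in>F. (\<lambda>x. f x + g x) \<in> F \<and> (\<lambda>x. f x - g x) \<in> F \<and> (\<lambda>x. f x * g x) \<in> F)"

lemma fun_ringD:
  assumes "fun_ring F"
  shows "(\<lambda>_. 0) \<in> F" "(\<lambda>_. 1) \<in> F"
    "f \<in> F \<Longrightarrow> g \<in> F \<Longrightarrow> (\<lambda>x. f x + g x) \<in> F"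
    "f \<in> F \<Longrightarrow> g \<in> F \<Longrightarrow> (\<lambda>x. f x - g x) \<in> F"
    "f \<in> F \<Longrightarrow> g \<in> F \<Longrightarrow> (\<lambda>x. f x * g x) \<in> F"
  using assms unfolding fun_ring_def by auto

lemma fun_ring_sum:
  assumes F: "fun_ring F" and "\<And>j. j \<in> J \<Longrightarrow> f j \<in> F"
  shows "(\<lambda>x. \<Sum>j\<in>J. f j x) \<in> F"
  using assms(2)
  by (induction J rule: infinite_finite_induct) (simp_all add: fun_ringD(1,3)[OF F])

lemma fun_ring_prod:
  assumes F: "fun_ring F" and "\<And>j. j \<in> J \<Longrightarrow> f j \<in> F"
  shows "(\<lambda>x. \<Prod>j\<in>J. f j x) \<in> F"
  using assms(2)
  by (induction J rule: infinite_finite_induct) (simp_all add: fun_ringD(2,5)[OF F])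

lemma fun_ring_ip:
  assumes F: "fun_ring F"
    and "\<And>i. i \<in> I \<Longrightarrow> (\<lambda>x. r x i) \<in> F" "\<And>i. i \<in> I \<Longrightarrow> (\<lambda>x. s x i) \<in> F"
  shows "(\<lambda>x. ip I (r x) (s x)) \<in> F"
  unfolding ip_def by (intro fun_ring_sum[OF F] fun_ringD(5)[OF F] assms)

text \<open>For finite \<open>I\<close> and \<open>S\<close>, it vanishes exactly where some member
  of \<open>S\<close> becomes zero on \<open>I\<close>.\<close>

definition nrms :: "'i set \<Rightarrow> ('x \<Rightarrow> 'i \<Rightarrow> real) set \<Rightarrow> 'x \<Rightarrow> real" where
  "nrms I S x = (\<Prod>s\<in>S. ip I (s x) (s x))"

text \<open>For orthogonal \<open>S\<close>, the component of \<open>r\<close> orthogonal to the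
  span of \<open>S\<close>, with denominators cleared: \<open>nrms I (S - {s})\<close> stands for
  \<open>nrms I S\<close> divided by the squared norm of \<open>s\<close>.\<close>

definition resid :: "'i set \<Rightarrow> ('x \<Rightarrow> 'i \<Rightarrow> real) set \<Rightarrow> ('x \<Rightarrow> 'i \<Rightarrow> real) \<Rightarrow> 'x \<Rightarrow> 'i \<Rightarrow> real" where
  "resid I S r x i = nrms I S x * r x i -
     (\<Sum>s\<in>S. nrms I (S - {s}) x * ip I (r x) (s x) * s x i)"

text \<open>Orthogonality is demanded at all parameters, so that projections built at one base point
  remain valid at every other parameter.\<close>

definition orth_family :: "'i set \<Rightarrow> ('x \<Rightarrow> 'i \<Rightarrow> real) set \<Rightarrow> bool" where
  "orth_family I S \<longleftrightarrow> (\<forall>s\<in>S. \<forall>t\<in>S. s \<noteq> t \<longrightarrow> (\<forall>x. ip I (s x) (t x) = 0))"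

lemma ip_resid:
  "ip I (resid I S r x) v = nrms I S x * ip I (r x) v -
     (\<Sum>s\<in>S. nrms I (S - {s}) x * ip I (r x) (s x) * ip I (s x) v)"
  unfolding resid_def ip_diff_left ip_scale_left ip_comb_left ..

lemma ip_resid_orth:
  assumes "\<And>s. s \<in> S \<Longrightarrow> ip I (s x) v = 0"
  shows "ip I (resid I S r x) v = nrms I S x * ip I (r x) v"
  using assms by (simp add: ip_resid)

lemma ip_resid_member:
  assumes "finite S" "orth_family I S" "t \<in> S"
  shows "ip I (resid I S r x) (t x) = 0"
proof -
  have "(\<Sum>s\<in>S. nrms I (S - {s}) x * ip I (r x) (s x) * ip I (s x) (t x))
      = (\<Sum>s\<in>S. if s = t then nrms I (S - {t}) x * ip I (r x) (t x) * ip I (t x) (t x) else 0)"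
    using assms by (intro sum.cong) (auto simp: orth_family_def)
  also have "\<dots> = nrms I S x * ip I (r x) (t x)"
    using assms by (simp add: nrms_def prod.remove[of S t])
  finally show ?thesis by (simp add: ip_resid)
qed

lemma ip_resid_self:
  assumes "finite S" "orth_family I S"
  shows "ip I (resid I S r x) (resid I S r x) = nrms I S x * ip I (r x) (resid I S r x)"
  by (rule ip_resid_orth) (subst ip_commute, rule ip_resid_member[OF assms])

text \<open>By duality, the hypothesis on \<open>v\<close> places \<open>r x\<close> in the span of
  \<open>S\<close>. The residual is orthogonal to \<open>S\<close>, hence to \<open>r x\<close>, and
  by \<open>ip_resid_self\<close> its squared norm is a multiple of that inner product.\<close>

lemma resid_eq_0:
  assumes "finite I" "finite S" "orth_family I S"
    and "\<And>v. (\<And>s. s \<in> S \<Longrightarrow> ip I v (s x) = 0) \<Longrightarrow> ip I v (r x) = 0"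
    and "i \<in> I"
  shows "resid I S r x i = 0"
proof -
  have "ip I (resid I S r x) (r x) = 0"
    by (rule assms(4)) (rule ip_resid_member[OF assms(2,3)])
  then have "ip I (resid I S r x) (resid I S r x) = 0"
    by (simp add: ip_resid_self[OF assms(2,3)] ip_commute)
  then show ?thesis using assms(1,5) by (simp add: ip_self_eq_0_iff)
qed

text \<open>Coefficients lie in \<open>F\<close>, but entries of the rows need not. This matters for
  distance-invariant polynomials: entries of edge rows change under isometries, their inner products
  do not.\<close>

definition comb :: "('x \<Rightarrow> real) set \<Rightarrow> ('x \<Rightarrow> 'i \<Rightarrow> real) set \<Rightarrow> ('x \<Rightarrow> 'i \<Rightarrow> real) \<Rightarrow> bool" where
  "comb F R s \<longleftrightarrow> (\<exists>c. (\<forall>r\<in>R. c r \<in> F) \<and> s = (\<lambda>x i. \<Sum>r\<in>R. c r x * r x i))"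

lemma comb_base:
  assumes "fun_ring F" "finite R" "r \<in> R"
  shows "comb F R r"
  unfolding comb_def
proof (intro exI[of _ "\<lambda>r' x. if r' = r then 1 else 0"] conjI ballI ext)
  fix r' show "(\<lambda>x. if r' = r then 1 else 0) \<in> F"
    using fun_ringD(1,2)[OF assms(1)] by simp
  fix x i show "r x i = (\<Sum>r'\<in>R. (if r' = r then 1 else 0) * r' x i)"
    using assms(2,3) by (simp add: if_distrib[of "\<lambda>c. c * _"] cong: if_cong)
qed

lemma comb_scale:
  assumes "fun_ring F" "comb F R s" "f \<in> F"
  shows "comb F R (\<lambda>x i. f x * s x i)"
proof -
  obtain c where c: "\<forall>r\<in>R. c r \<in> F" "s = (\<lambda>x i. \<Sum>r\<in>R. c r x * r x i)"
    using assms(2) by (auto simp: comb_def)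
  have "(\<lambda>x. f x * c r x) \<in> F" if "r \<in> R" for r
    using c(1) that by (intro fun_ringD(5)[OF assms(1,3)]) blast
  moreover have "(\<lambda>x i. f x * s x i) = (\<lambda>x i. \<Sum>r\<in>R. (f x * c r x) * r x i)"
    unfolding c(2) by (simp add: sum_distrib_left mult.assoc)
  ultimately show ?thesis
    unfolding comb_def by (intro exI[of _ "\<lambda>r x. f x * c r x"]) blast
qed

lemma comb_diff:
  assumes "fun_ring F" "comb F R s" "comb F R t"
  shows "comb F R (\<lambda>x i. s x i - t x i)"
proof -
  obtain c where c: "\<forall>r\<in>R. c r \<in> F" "s = (\<lambda>x i. \<Sum>r\<in>R. c r x * r x i)"
    using assms(2) by (auto simp: comb_def)
  obtain e where e: "\<forall>r\<in>R. e r \<in> F" "t = (\<lambda>x i. \<Sum>r\<in>R. e r x * r x i)"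
    using assms(3) by (auto simp: comb_def)
  have "(\<lambda>x. c r x - e r x) \<in> F" if "r \<in> R" for r
    using c(1) e(1) that by (intro fun_ringD(4)[OF assms(1)]) blast+
  moreover have "(\<lambda>x i. s x i - t x i) = (\<lambda>x i. \<Sum>r\<in>R. (c r x - e r x) * r x i)"
    unfolding c(2) e(2) by (simp add: left_diff_distrib sum_subtractf)
  ultimately show ?thesis
    unfolding comb_def by (intro exI[of _ "\<lambda>r x. c r x - e r x"]) blast
qed

lemma comb_sum:
  assumes "fun_ring F" "\<And>j. j \<in> J \<Longrightarrow> comb F R (s j)"
  shows "comb F R (\<lambda>x i. \<Sum>j\<in>J. s j x i)"
proof -
  have "\<forall>j\<in>J. \<exists>c. (\<forall>r\<in>R. c r \<in> F) \<and> s j = (\<lambda>x i. \<Sum>r\<in>R. c r x * r x i)"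
    using assms(2) by (simp add: comb_def)
  from bchoice[OF this] obtain c
    where c: "\<forall>j\<in>J. (\<forall>r\<in>R. c j r \<in> F) \<and> s j = (\<lambda>x i. \<Sum>r\<in>R. c j r x * r x i)" ..
  show ?thesis
    unfolding comb_def
  proof (intro exI[of _ "\<lambda>r x. \<Sum>j\<in>J. c j r x"] conjI ballI ext)
    fix r assume "r \<in> R"
    then show "(\<lambda>x. \<Sum>j\<in>J. c j r x) \<in> F"
      using c by (intro fun_ring_sum[OF assms(1)]) blast
  next
    fix x i
    have "(\<Sum>j\<in>J. s j x i) = (\<Sum>j\<in>J. \<Sum>r\<in>R. c j r x * r x i)"
      using c by (intro sum.cong refl) simp
    also have "\<dots> = (\<Sum>r\<in>R. (\<Sum>j\<in>J. c j r x) * r x i)"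
      by (subst sum.swap) (simp add: sum_distrib_right)
    finally show "(\<Sum>j\<in>J. s j x i) = (\<Sum>r\<in>R. (\<Sum>j\<in>J. c j r x) * r x i)" .
  qed
qed

definition gram_in :: "('x \<Rightarrow> real) set \<Rightarrow> 'i set \<Rightarrow> ('x \<Rightarrow> 'i \<Rightarrow> real) set \<Rightarrow> bool" where
  "gram_in F I R \<longleftrightarrow> (\<forall>r\<in>R. \<forall>s\<in>R. (\<lambda>x. ip I (r x) (s x)) \<in> F)"

lemma ip_comb_in:
  assumes F: "fun_ring F" and R: "gram_in F I R" and "comb F R s" "comb F R t"
  shows "(\<lambda>x. ip I (s x) (t x)) \<in> F"
proof -
  obtain c where c: "\<forall>r\<in>R. c r \<in> F" "s = (\<lambda>x i. \<Sum>r\<in>R. c r x * r x i)"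
    using assms(3) by (auto simp: comb_def)
  obtain e where e: "\<forall>r\<in>R. e r \<in> F" "t = (\<lambda>x i. \<Sum>r\<in>R. e r x * r x i)"
    using assms(4) by (auto simp: comb_def)
  have "(\<lambda>x. ip I (s x) (t x)) = (\<lambda>x. \<Sum>r\<in>R. c r x * (\<Sum>r'\<in>R. e r' x * ip I (r x) (r' x)))"
    unfolding c e ip_comb_left ip_comb_right ..
  also have "\<dots> \<in> F"
    using c e R unfolding gram_in_def
    by (intro fun_ring_sum[OF F] fun_ringD(5)[OF F]) auto
  finally show ?thesis .
qed

lemma nrms_in:
  assumes "fun_ring F" "gram_in F I R" "\<And>s. s \<in> S \<Longrightarrow> comb F R s"
  shows "nrms I S \<in> F"
  unfolding nrms_def[abs_def]
  by (intro fun_ring_prod[OF assms(1)] ip_comb_in[OF assms(1,2)] assms(3))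

lemma comb_resid:
  assumes F: "fun_ring F" and R: "gram_in F I R" "finite R" and S: "\<And>s. s \<in> S \<Longrightarrow> comb F R s"
    and r: "r \<in> R"
  shows "comb F R (resid I S r)"
  unfolding resid_def[abs_def]
  by (intro comb_diff comb_scale comb_sum comb_base[OF F R(2) r] nrms_in[OF F R(1)]
      fun_ringD(5)[OF F] ip_comb_in[OF F R(1)] F S) auto

text \<open>\<open>Q\<close> holds the rows treated so far, \<open>R\<close> those that may occur in
  combinations. Nondegeneracy and spanning are required at \<open>x0\<close> only; spanning is
  expressed through orthogonal complements.\<close>

definition gs_system ::
  "('x \<Rightarrow> real) set \<Rightarrow> 'i set \<Rightarrow> ('x \<Rightarrow> 'i \<Rightarrow> real) set \<Rightarrow> 'x \<Rightarrow> ('x \<Rightarrow> 'i \<Rightarrow> real) set \<Rightarrow>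
    ('x \<Rightarrow> 'i \<Rightarrow> real) set \<Rightarrow> bool" where
  "gs_system F I R x0 Q S \<longleftrightarrow> finite S \<and> (\<forall>s\<in>S. comb F R s) \<and> orth_family I S \<and> nrms I S x0 \<noteq> 0 \<and>
     (\<forall>v. (\<forall>s\<in>S. ip I v (s x0) = 0) \<longrightarrow> (\<forall>r\<in>Q. ip I v (r x0) = 0))"

lemma gs_systemD:
  assumes "gs_system F I R x0 Q S"
  shows "finite S" "s \<in> S \<Longrightarrow> comb F R s" "orth_family I S" "nrms I S x0 \<noteq> 0"
    "(\<And>s. s \<in> S \<Longrightarrow> ip I v (s x0) = 0) \<Longrightarrow> r \<in> Q \<Longrightarrow> ip I v (r x0) = 0"
  using assms unfolding gs_system_def by blast+

text \<open>Rows are added one at a time: a row already in the span at \<open>x0\<close> is skipped,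
  any other contributes its residual.\<close>

lemma gs_exists_subset:
  assumes F: "fun_ring F" and R: "gram_in F I R" "finite R" and Q: "Q \<subseteq> R" and I: "finite I"
  shows "\<exists>S. gs_system F I R x0 Q S"
  using finite_subset[OF Q R(2)] Q
proof (induction Q rule: finite_induct)
  case empty
  then show ?case by (intro exI[of _ "{}"]) (simp add: gs_system_def orth_family_def nrms_def)
next
  case (insert r Q)
  then obtain S where S: "gs_system F I R x0 Q S" by blast
  note fin = gs_systemD(1)[OF S] and orth = gs_systemD(3)[OF S] and N0 = gs_systemD(4)[OF S]
  show ?case
  proof (cases "\<forall>v. (\<forall>s\<in>S. ip I v (s x0) = 0) \<longrightarrow> ip I v (r x0) = 0")
    case True
    with S have "gs_system F I R x0 (insert r Q) S" unfolding gs_system_def by blast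
    then show ?thesis ..
  next
    case False
    \<comment> \<open>A vector witnessing that \<open>r x0\<close> is outside the span; pairing the
      residual with it shows that the residual is nonzero at \<open>x0\<close>.\<close>
    then obtain v where v: "\<And>s. s \<in> S \<Longrightarrow> ip I v (s x0) = 0" "ip I v (r x0) \<noteq> 0" by auto
    define t where "t = resid I S r"
    have "ip I (t x0) v = nrms I S x0 * ip I (r x0) v"
      unfolding t_def by (rule ip_resid_orth) (simp add: v ip_commute[of I _ v])
    then have "ip I (t x0) v \<noteq> 0" using v N0 by (simp add: ip_commute[of I _ v])
    then have t0: "ip I (t x0) (t x0) \<noteq> 0"
      using I by (metis (no_types, lifting) ip_def ip_self_eq_0_iff mult_zero_left sum.neutral)
    have tS: "ip I (t x) (s x) = 0" if "s \<in> S" for s x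
      unfolding t_def using ip_resid_member[OF fin orth that] .
    have tn: "t \<notin> S" using tS t0 by auto
    have "comb F R t" unfolding t_def
      using gs_systemD(2)[OF S] insert.prems by (intro comb_resid[OF F R]) auto
    moreover have "orth_family I (insert t S)"
      using orth tS unfolding orth_family_def by (metis insert_iff ip_commute)
    moreover have "nrms I (insert t S) x0 \<noteq> 0"
      using N0 t0 tn fin by (simp add: nrms_def)
    moreover have "ip I v (r x0) = 0" if "\<forall>s\<in>insert t S. ip I v (s x0) = 0" for v
    proof -
      have "ip I (t x0) v = nrms I S x0 * ip I (r x0) v"
        unfolding t_def by (rule ip_resid_orth) (use that in \<open>simp add: ip_commute[of I _ v]\<close>)
      moreover have "ip I (t x0) v = 0" using that by (simp add: ip_commute[of I _ v])
      ultimately show ?thesis using N0 by (simp add: ip_commute[of I _ v])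
    qed
    ultimately have "gs_system F I R x0 (insert r Q) (insert t S)"
      using S unfolding gs_system_def by blast
    then show ?thesis ..
  qed
qed

lemma gs_exists:
  assumes "fun_ring F" "gram_in F I R" "finite R" "finite I"
  obtains S where "gs_system F I R x0 R S"
  using gs_exists_subset[OF assms(1-3) subset_refl assms(4), of x0] by (elim exE)

text \<open>Being a combination of rows is an identity in the parameter, so this direction holds at
  every \<open>x\<close>, even where \<open>S\<close> degenerates.\<close>

lemma gs_orth:
  assumes "gs_system F I R x0 Q S" "s \<in> S" "\<And>r. r \<in> R \<Longrightarrow> ip I v (r x) = 0"
  shows "ip I v (s x) = 0"
proof -
  obtain c where "s = (\<lambda>x i. \<Sum>r\<in>R. c r x * r x i)"
    using assms(1,2) by (auto simp: gs_system_def comb_def)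
  then show ?thesis using assms(3) by (simp add: ip_comb_right)
qed

text \<open>The squared distances of the standard basis vectors to the span of \<open>S\<close> add up to
  \<open>card I - card S\<close>, so whether \<open>S\<close> spans does not depend on the parameter.\<close>

lemma sum_proj_defect:
  fixes I :: "'i set"
  assumes I: "finite I" and S: "finite S" "orth_family I S" "nrms I S x \<noteq> 0"
  defines "u \<equiv> (\<lambda>i j. (if j = i then 1 else 0) - (\<Sum>s\<in>S. (s x i / ip I (s x) (s x)) * s x j))"
  shows "i \<in> I \<Longrightarrow> s \<in> S \<Longrightarrow> ip I (u i) (s x) = 0"
    and "(\<Sum>i\<in>I. ip I (u i) (u i)) = real (card I) - real (card S)"
proof -
  have nz: "ip I (s x) (s x) \<noteq> 0" if "s \<in> S" for s
    using S that by (simp add: nrms_def)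
  have uv: "ip I (u i) v = v i - (\<Sum>s\<in>S. (s x i / ip I (s x) (s x)) * ip I (s x) v)"
    if "i \<in> I" for i v
    unfolding u_def ip_diff_left ip_comb_left ip_unit[OF I that] ..
  show us: "ip I (u i) (s x) = 0" if "i \<in> I" "s \<in> S" for i s
  proof -
    have "(\<Sum>t\<in>S. (t x i / ip I (t x) (t x)) * ip I (t x) (s x)) = (\<Sum>t\<in>S. if t = s then s x i else 0)"
      using S(2) nz that by (intro sum.cong) (auto simp: orth_family_def)
    then show ?thesis using that S(1) by (simp add: uv)
  qed
  have "ip I (u i) (u i) = 1 - (\<Sum>s\<in>S. s x i * s x i / ip I (s x) (s x))" if "i \<in> I" for i
  proof -
    have "ip I (s x) (u i) = 0" if "s \<in> S" for s
      using us[OF \<open>i \<in> I\<close> that] by (simp only: ip_commute)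
    then have "ip I (u i) (u i) = u i i" unfolding uv[OF that] by simp
    then show ?thesis by (simp add: u_def)
  qed
  then have "(\<Sum>i\<in>I. ip I (u i) (u i)) = card I - (\<Sum>i\<in>I. \<Sum>s\<in>S. s x i * s x i / ip I (s x) (s x))"
    by (simp add: sum_subtractf)
  also have "(\<Sum>i\<in>I. \<Sum>s\<in>S. s x i * s x i / ip I (s x) (s x))
      = (\<Sum>s\<in>S. \<Sum>i\<in>I. s x i * s x i / ip I (s x) (s x))"
    by (rule sum.swap)
  also have "(\<Sum>s\<in>S. \<Sum>i\<in>I. s x i * s x i / ip I (s x) (s x)) = (\<Sum>s\<in>S. 1)"
    using nz by (intro sum.cong) (auto simp: ip_def simp flip: sum_divide_distrib)
  finally show "(\<Sum>i\<in>I. ip I (u i) (u i)) = real (card I) - real (card S)" by simp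
qed

section \<open>Full rank as an open condition\<close>

definition ker_zero :: "'i set \<Rightarrow> ('x \<Rightarrow> 'i \<Rightarrow> real) set \<Rightarrow> 'x \<Rightarrow> bool" where
  "ker_zero I R x \<longleftrightarrow> (\<forall>v. (\<forall>r\<in>R. ip I v (r x) = 0) \<longrightarrow> (\<forall>i\<in>I. v i = 0))"

text \<open>\<open>N\<close> is \<open>nrms I S\<close>. At \<open>x0\<close> the system spans, so
  all projection defects vanish and \<open>card S = card I\<close>. Wherever \<open>N\<close> is
  nonzero the defects again add up to zero, so \<open>S\<close> spans there as well, and the kernel
  of \<open>R\<close> lies in that of \<open>S\<close>.\<close>

lemma ker_zero_open:
  fixes I :: "'i set"
  assumes F: "fun_ring F" "gram_in F I R" "finite R" and I: "finite I" and x0: "ker_zero I R x0"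
  shows "\<exists>N\<in>F. N x0 \<noteq> 0 \<and> (\<forall>x. N x \<noteq> 0 \<longrightarrow> ker_zero I R x)"
proof -
  obtain S where S: "gs_system F I R x0 R S" using gs_exists[OF F I] .
  define u where "u x i j = (if j = i then 1 else 0) - (\<Sum>s\<in>S. (s x i / ip I (s x) (s x)) * s x j)"
    for x and i j :: 'i
  have fin: "finite S" "orth_family I S" using gs_systemD(1,3)[OF S] .
  have u1: "ip I (u x i) (s x) = 0" if "nrms I S x \<noteq> 0" "i \<in> I" "s \<in> S" for x i s
    using sum_proj_defect(1)[OF I fin that] unfolding u_def by blast
  have u2: "(\<Sum>i\<in>I. ip I (u x i) (u x i)) = real (card I) - real (card S)" if "nrms I S x \<noteq> 0" for x
    using sum_proj_defect(2)[OF I fin that] unfolding u_def by blast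
  have "ip I (u x0 i) (u x0 i) = 0" if "i \<in> I" for i
  proof -
    have "\<forall>r\<in>R. ip I (u x0 i) (r x0) = 0"
      using gs_systemD(5)[OF S] u1[OF gs_systemD(4)[OF S] that] by blast
    then have "\<forall>j\<in>I. u x0 i j = 0" using x0 unfolding ker_zero_def by blast
    then show ?thesis by (simp add: ip_def)
  qed
  with u2[OF gs_systemD(4)[OF S]] have card: "real (card I) - real (card S) = 0" by simp
  show ?thesis
  proof (intro bexI[of _ "nrms I S"] conjI allI impI)
    show "nrms I S \<in> F" using gs_systemD(2)[OF S] by (rule nrms_in[OF F(1,2)])
    show "nrms I S x0 \<noteq> 0" using gs_systemD(4)[OF S] .
    fix x assume N: "nrms I S x \<noteq> 0"
    show "ker_zero I R x" unfolding ker_zero_def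
    proof (intro allI impI ballI)
      fix v i assume v: "\<forall>r\<in>R. ip I v (r x) = 0" and i: "i \<in> I"
      have vs: "ip I (s x) v = 0" if "s \<in> S" for s
        using gs_orth[OF S that, of v x] v by (simp only: ip_commute)
      have "(\<Sum>i\<in>I. ip I (u x i) (u x i)) = 0" using u2[OF N] card by simp
      then have "\<forall>i\<in>I. ip I (u x i) (u x i) = 0"
        by (subst (asm) sum_nonneg_eq_0_iff) (simp_all add: I ip_self_nonneg)
      then have ui: "\<forall>j\<in>I. u x i j = 0" using i I by (simp add: ip_self_eq_0_iff)
      \<comment> \<open>Pairing a vector orthogonal to \<open>S\<close> with the defect of the
        \<open>i\<close>-th basis vector returns its \<open>i\<close>-th coordinate.\<close>
      have "0 = ip I (u x i) v" using ui by (simp add: ip_def)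
      also have "\<dots> = v i"
        unfolding u_def ip_diff_left ip_comb_left
        using i vs by (simp add: ip_unit[OF I])
      finally show "v i = 0" by simp
    qed
  qed
qed

text \<open>Gram--Schmidt over a one-point parameter space and the ring of all functions, where
  division is harmless.\<close>

lemma orth_projection:
  fixes t :: "'j \<Rightarrow> 'i \<Rightarrow> real"
  assumes I: "finite I" and J: "finite J"
  shows "\<exists>c. \<forall>j\<in>J. ip I (\<lambda>i. w i - (\<Sum>j\<in>J. c j * t j i)) (t j) = 0"
proof -
  define R where "R = (\<lambda>j (_::unit). t j) ` J"
  \<comment> \<open>Distinct indices may carry equal vectors. Representatives \<open>J'\<close> turn
    coefficients over the set of vectors into coefficients over \<open>J\<close>, with 0 outside
    \<open>J'\<close>.\<close>
  have "\<exists>J'\<subseteq>J. inj_on (\<lambda>j (_::unit). t j) J' \<and> R = (\<lambda>j _. t j) ` J'"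
    by (rule subset_image_inj[THEN iffD1]) (simp add: R_def)
  then obtain J' where J': "J' \<subseteq> J" "inj_on (\<lambda>j (_::unit). t j) J'" "R = (\<lambda>j _. t j) ` J'"
    by blast
  have "fun_ring (UNIV :: (unit \<Rightarrow> real) set)" by (simp add: fun_ring_def)
  moreover have "gram_in UNIV I R" by (simp add: gram_in_def)
  moreover have "finite R" using J by (simp add: R_def)
  ultimately obtain S where S: "gs_system UNIV I R () R S" by (rule gs_exists[OF _ _ _ I])
  have "comb UNIV R (\<lambda>x i. \<Sum>s\<in>S. (ip I w (s ()) / ip I (s ()) (s ())) * s x i)"
    using gs_systemD(2)[OF S] by (intro comb_sum comb_scale) (simp_all add: fun_ring_def)
  then obtain c where c: "(\<lambda>x i. \<Sum>s\<in>S. (ip I w (s ()) / ip I (s ()) (s ())) * s x i)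
      = (\<lambda>x i. \<Sum>r\<in>R. c r x * r x i)" unfolding comb_def by blast
  define e where "e j = (if j \<in> J' then c (\<lambda>_. t j) () else 0)" for j
  have "(\<Sum>j\<in>J. e j * t j i) = (\<Sum>s\<in>S. (ip I w (s ()) / ip I (s ()) (s ())) * s () i)" for i
  proof -
    have "(\<Sum>j\<in>J. e j * t j i) = (\<Sum>j\<in>J'. c (\<lambda>_. t j) () * t j i)"
      using J J'(1) by (intro sum.mono_neutral_cong_right) (auto simp: e_def)
    also have "\<dots> = (\<Sum>r\<in>R. c r () * r () i)"
      unfolding J'(3) by (subst sum.reindex[OF J'(2)]) simp
    finally show ?thesis using fun_cong[OF fun_cong[OF c, of "()"], of i] by simp
  qed
  then have e: "(\<lambda>i. w i - (\<Sum>j\<in>J. e j * t j i))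
      = (\<lambda>i. w i - (\<Sum>s\<in>S. (ip I w (s ()) / ip I (s ()) (s ())) * s () i))" by simp
  have orth: "ip I (\<lambda>i. w i - (\<Sum>j\<in>J. e j * t j i)) (s ()) = 0" if "s \<in> S" for s
  proof -
    have nz: "ip I (s ()) (s ()) \<noteq> 0" using gs_systemD(1,4)[OF S] that by (simp add: nrms_def)
    have "(\<Sum>r\<in>S. (ip I w (r ()) / ip I (r ()) (r ())) * ip I (r ()) (s ()))
        = (\<Sum>r\<in>S. if r = s then ip I w (s ()) else 0)"
      using gs_systemD(3)[OF S] nz that by (intro sum.cong) (auto simp: orth_family_def)
    then show ?thesis unfolding e ip_diff_left ip_comb_left using gs_systemD(1)[OF S] that by simp
  qed
  have "ip I (\<lambda>i. w i - (\<Sum>j\<in>J. e j * t j i)) (t j) = 0" if "j \<in> J" for j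
    using gs_systemD(5)[OF S, of "\<lambda>i. w i - (\<Sum>j\<in>J. e j * t j i)" "\<lambda>_. t j"] orth that
    unfolding R_def by blast
  then show ?thesis by blast
qed

section \<open>Rational polynomial functions and generic points\<close>

abbreviation lookup where "lookup \<equiv> Poly_Mapping.lookup"
abbreviation keys where "keys \<equiv> Poly_Mapping.keys"

definition monomial_eval :: "('i \<Rightarrow> real) \<Rightarrow> ('i \<Rightarrow>\<^sub>0 nat) \<Rightarrow> real" where
  "monomial_eval x m = (\<Prod>i\<in>keys m. x i ^ lookup m i)"

lemma monomial_eval_superset:
  "finite A \<Longrightarrow> keys m \<subseteq> A \<Longrightarrow> monomial_eval x m = (\<Prod>i\<in>A. x i ^ lookup m i)"
  unfolding monomial_eval_def by (rule prod.mono_neutral_left) (auto simp: in_keys_iff)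

lemma monomial_eval_add: "monomial_eval x (m + n) = monomial_eval x m * monomial_eval x n"
proof -
  have "finite (keys m \<union> keys n)" by simp
  note s = monomial_eval_superset[OF this]
  show ?thesis
    using s[of m] s[of n] s[of "m + n"] Poly_Mapping.keys_add[of m n]
    by (simp add: lookup_add power_add prod.distrib)
qed

lemma rat_mpoly_eval_superset:
  "finite A \<Longrightarrow> keys P \<subseteq> A \<Longrightarrow> rat_mpoly_eval x P = (\<Sum>m\<in>A. of_rat (lookup P m) * monomial_eval x m)"
  unfolding rat_mpoly_eval_def monomial_eval_def
      by (rule sum.mono_neutral_left) (auto simp: in_keys_iff)

lemma rat_mpoly_eval_zero: "rat_mpoly_eval x 0 = 0"
  by (simp add: rat_mpoly_eval_def)

lemma rat_mpoly_eval_add: "rat_mpoly_eval x (P + Q) = rat_mpoly_eval x P + rat_mpoly_eval x Q"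
proof -
  have "finite (keys P \<union> keys Q)" by simp
  note s = rat_mpoly_eval_superset[OF this]
  show ?thesis
    using s[of P] s[of Q] s[of "P + Q"] Poly_Mapping.keys_add[of P Q]
    by (simp add: lookup_add of_rat_add distrib_right sum.distrib)
qed

lemma rat_mpoly_eval_single: "rat_mpoly_eval x (Poly_Mapping.single m c)
    = of_rat c * monomial_eval x m"
  by (simp add: rat_mpoly_eval_superset[of "{m}"])

lemma rat_mpoly_eval_sum: "rat_mpoly_eval x (\<Sum>j\<in>J. P j) = (\<Sum>j\<in>J. rat_mpoly_eval x (P j))"
  by (induction J rule: infinite_finite_induct) (simp_all add: rat_mpoly_eval_zero rat_mpoly_eval_add)

lemma poly_mapping_sum_single: "P = (\<Sum>m\<in>keys P. Poly_Mapping.single m (lookup P m))"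
  by (rule poly_mapping_eqI) (simp add: lookup_sum lookup_single when_def in_keys_iff)

lemma rat_mpoly_eval_mult: "rat_mpoly_eval x (P * Q) = rat_mpoly_eval x P * rat_mpoly_eval x Q"
proof -
  have "P * Q = (\<Sum>m\<in>keys P. Poly_Mapping.single m (lookup P m))
      * (\<Sum>m\<in>keys Q. Poly_Mapping.single m (lookup Q m))"
    by (simp only: poly_mapping_sum_single[symmetric])
  also have "\<dots> = (\<Sum>m\<in>keys P. \<Sum>n\<in>keys Q. Poly_Mapping.single (m + n) (lookup P m * lookup Q n))"
    by (simp add: sum_product mult_single)
  finally have "rat_mpoly_eval x (P * Q) = (\<Sum>m\<in>keys P. \<Sum>n\<in>keys Q.
      (of_rat (lookup P m) * monomial_eval x m) * (of_rat (lookup Q n) * monomial_eval x n))"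
    by (simp add: rat_mpoly_eval_sum rat_mpoly_eval_single monomial_eval_add of_rat_mult mult_ac)
  then show ?thesis
    unfolding sum_product[symmetric] by (simp add: rat_mpoly_eval_def monomial_eval_def)
qed

text \<open>The inductive form gives continuity and Lipschitz bounds by rule induction;
  \<open>ratpoly_eval\<close> connects it with formal polynomials.\<close>

inductive_set ratpoly :: "'i set \<Rightarrow> (('i \<Rightarrow> real) \<Rightarrow> real) set" for I where
  const: "(\<lambda>_. of_rat c) \<in> ratpoly I"
| var: "i \<in> I \<Longrightarrow> (\<lambda>x. x i) \<in> ratpoly I"
| add: "f \<in> ratpoly I \<Longrightarrow> g \<in> ratpoly I \<Longrightarrow> (\<lambda>x. f x + g x) \<in> ratpoly I"
| mult: "f \<in> ratpoly I \<Longrightarrow> g \<in> ratpoly I \<Longrightarrow> (\<lambda>x. f x * g x) \<in> ratpoly I"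

lemma ratpoly_eval:
  assumes "f \<in> ratpoly I"
  shows "\<exists>P. (\<forall>m\<in>keys P. keys m \<subseteq> I) \<and> f = (\<lambda>x. rat_mpoly_eval x P)"
  using assms
proof induction
  case (const c)
  show ?case
    by (rule exI[of _ "Poly_Mapping.single 0 c"])
      (auto simp: rat_mpoly_eval_single monomial_eval_def split: if_splits)
next
  case (var i)
  then show ?case
    by (intro exI[of _ "Poly_Mapping.single (Poly_Mapping.single i 1) 1"])
      (auto simp: rat_mpoly_eval_single monomial_eval_def)
next
  case (add f g)
  then obtain P Q where "\<forall>m\<in>keys P. keys m \<subseteq> I" "f = (\<lambda>x. rat_mpoly_eval x P)"
    "\<forall>m\<in>keys Q. keys m \<subseteq> I" "g = (\<lambda>x. rat_mpoly_eval x Q)" by blast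
  then show ?case
    using Poly_Mapping.keys_add[of P Q] by (intro exI[of _ "P + Q"]) (auto simp: rat_mpoly_eval_add)
next
  case (mult f g)
  then obtain P Q where P: "\<forall>m\<in>keys P. keys m \<subseteq> I" "f = (\<lambda>x. rat_mpoly_eval x P)"
    and Q: "\<forall>m\<in>keys Q. keys m \<subseteq> I" "g = (\<lambda>x. rat_mpoly_eval x Q)" by blast
  have "keys m \<subseteq> I" if m: "m \<in> keys (P * Q)" for m
  proof -
    obtain a b where "m = a + b" "a \<in> keys P" "b \<in> keys Q"
      using subsetD[OF keys_mult m] by blast
    then show ?thesis using P(1) Q(1) Poly_Mapping.keys_add[of a b] by blast
  qed
  then show ?case using P Q by (intro exI[of _ "P * Q"]) (simp add: rat_mpoly_eval_mult)
qed

text \<open>Genericity makes the underlying polynomial itself zero. Mostly used in contrapositive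
  form: nonvanishing at one special \<open>y\<close> gives nonvanishing at the generic
  \<open>x\<close>.\<close>

lemma generic_zero:
  assumes "alg_independent_over_rat I x" "f \<in> ratpoly I" "f x = 0"
  shows "f y = 0"
proof -
  obtain P where P: "\<forall>m\<in>keys P. keys m \<subseteq> I" "f = (\<lambda>x. rat_mpoly_eval x P)"
    using ratpoly_eval[OF assms(2)] by blast
  then have "P = 0" using assms(1,3) by (simp add: alg_independent_over_rat_def)
  then show ?thesis using P(2) by (simp add: rat_mpoly_eval_zero)
qed

lemma alg_independent_over_rat_subset:
  "alg_independent_over_rat I x \<Longrightarrow> J \<subseteq> I \<Longrightarrow> alg_independent_over_rat J x"
  unfolding alg_independent_over_rat_def by blast

lemma ratpoly_tendsto:
  assumes "f \<in> ratpoly I" "\<And>i. i \<in> I \<Longrightarrow> ((\<lambda>t. x t i) \<longlongrightarrow> y i) F"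
  shows "((\<lambda>t. f (x t)) \<longlongrightarrow> f y) F"
  using assms(1) by induction (simp_all add: tendsto_add tendsto_mult assms(2))

lemma ratpoly_continuous_on:
  assumes "f \<in> ratpoly I" "\<And>i. i \<in> I \<Longrightarrow> continuous_on T (\<lambda>t. x t i)"
  shows "continuous_on T (\<lambda>t. f (x t))"
  using assms(2) unfolding continuous_on_def by (blast intro: ratpoly_tendsto[OF assms(1)])

text \<open>The bound and the Lipschitz constant are proved together because the product step needs
  bounds on both factors.\<close>

lemma ratpoly_lipschitz:
  assumes "f \<in> ratpoly I" and I: "finite I"
  shows "\<exists>L\<ge>0. \<forall>x y. (\<forall>i\<in>I. \<bar>x i\<bar> \<le> M \<and> \<bar>y i\<bar> \<le> M) \<longrightarrow>
           \<bar>f x\<bar> \<le> L \<and> \<bar>f x - f y\<bar> \<le> L * (\<Sum>i\<in>I. \<bar>x i - y i\<bar>)"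
  using assms(1)
proof induction
  case (const c)
  show ?case by (rule exI[of _ "\<bar>of_rat c\<bar>"]) (simp add: sum_nonneg)
next
  case (var i)
  show ?case
  \<comment> \<open>The constant must be nonnegative whatever the sign of \<open>M\<close>, dominate
    \<open>M\<close>, and be at least 1, the Lipschitz constant of a coordinate.\<close>
  proof (intro exI[of _ "\<bar>M\<bar> + 1"] conjI allI impI)
    fix x y :: "'a \<Rightarrow> real" assume M: "\<forall>i\<in>I. \<bar>x i\<bar> \<le> M \<and> \<bar>y i\<bar> \<le> M"
    show "\<bar>x i\<bar> \<le> \<bar>M\<bar> + 1" using M[rule_format, OF var] by linarith
    have "1 * \<bar>x i - y i\<bar> \<le> (\<bar>M\<bar> + 1) * (\<Sum>i\<in>I. \<bar>x i - y i\<bar>)"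
      using I var by (intro mult_mono member_le_sum) auto
    then show "\<bar>x i - y i\<bar> \<le> (\<bar>M\<bar> + 1) * (\<Sum>i\<in>I. \<bar>x i - y i\<bar>)" by simp
  qed simp
next
  case (add f g)
  then obtain K L where K: "K \<ge> 0" "\<forall>x y. (\<forall>i\<in>I. \<bar>x i\<bar> \<le> M \<and> \<bar>y i\<bar> \<le> M) \<longrightarrow>
           \<bar>f x\<bar> \<le> K \<and> \<bar>f x - f y\<bar> \<le> K * (\<Sum>i\<in>I. \<bar>x i - y i\<bar>)"
    and L: "L \<ge> 0" "\<forall>x y. (\<forall>i\<in>I. \<bar>x i\<bar> \<le> M \<and> \<bar>y i\<bar> \<le> M) \<longrightarrow>
           \<bar>g x\<bar> \<le> L \<and> \<bar>g x - g y\<bar> \<le> L * (\<Sum>i\<in>I. \<bar>x i - y i\<bar>)" by blast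
  show ?case
  proof (intro exI[of _ "K + L"] conjI allI impI)
    fix x y :: "'a \<Rightarrow> real" assume M: "\<forall>i\<in>I. \<bar>x i\<bar> \<le> M \<and> \<bar>y i\<bar> \<le> M"
    note * = K(2)[THEN spec, THEN spec, THEN mp, OF M] L(2)[THEN spec, THEN spec, THEN mp, OF M]
    show "\<bar>f x + g x\<bar> \<le> K + L" using * by linarith
    show "\<bar>f x + g x - (f y + g y)\<bar> \<le> (K + L) * (\<Sum>i\<in>I. \<bar>x i - y i\<bar>)"
      unfolding distrib_right using * by linarith
  qed (use K L in simp)
next
  case (mult f g)
  then obtain K L where K: "K \<ge> 0" "\<forall>x y. (\<forall>i\<in>I. \<bar>x i\<bar> \<le> M \<and> \<bar>y i\<bar> \<le> M) \<longrightarrow>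
           \<bar>f x\<bar> \<le> K \<and> \<bar>f x - f y\<bar> \<le> K * (\<Sum>i\<in>I. \<bar>x i - y i\<bar>)"
    and L: "L \<ge> 0" "\<forall>x y. (\<forall>i\<in>I. \<bar>x i\<bar> \<le> M \<and> \<bar>y i\<bar> \<le> M) \<longrightarrow>
           \<bar>g x\<bar> \<le> L \<and> \<bar>g x - g y\<bar> \<le> L * (\<Sum>i\<in>I. \<bar>x i - y i\<bar>)" by blast
  show ?case
  proof (intro exI[of _ "2 * (K * L)"] conjI allI impI)
    fix x y :: "'a \<Rightarrow> real" assume M: "\<forall>i\<in>I. \<bar>x i\<bar> \<le> M \<and> \<bar>y i\<bar> \<le> M"
    \<comment> \<open>With the roles exchanged, since the bound on \<open>g\<close> is needed at
      \<open>y\<close>.\<close>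
    then have M': "\<forall>i\<in>I. \<bar>y i\<bar> \<le> M \<and> \<bar>x i\<bar> \<le> M" by blast
    let ?D = "\<Sum>i\<in>I. \<bar>x i - y i\<bar>"
    have D: "?D \<ge> 0" by (simp add: sum_nonneg)
    note * = K(2)[THEN spec, THEN spec, THEN mp, OF M] L(2)[THEN spec, THEN spec, THEN mp, OF M]
      L(2)[THEN spec, THEN spec, THEN mp, OF M']
    have "\<bar>f x * g x\<bar> \<le> K * L" using * K(1) by (simp add: abs_mult mult_mono)
    then show "\<bar>f x * g x\<bar> \<le> 2 * (K * L)" using K(1) L(1) mult_nonneg_nonneg[of K L] by linarith
    have "f x * g x - f y * g y = f x * (g x - g y) + (f x - f y) * g y"
      by (simp add: algebra_simps)
    also have "\<bar>\<dots>\<bar> \<le> \<bar>f x * (g x - g y)\<bar> + \<bar>(f x - f y) * g y\<bar>" by (rule abs_triangle_ineq)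
    also have "\<dots> \<le> K * (L * ?D) + (K * ?D) * L"
      using * K(1) L(1) D by (intro add_mono) (simp_all add: abs_mult mult_mono)
    finally show "\<bar>f x * g x - f y * g y\<bar> \<le> 2 * (K * L) * ?D" by (simp add: algebra_simps)
  qed (use K L in simp)
qed

lemma fun_ring_ratpoly: "fun_ring (ratpoly I)"
proof -
  have "(\<lambda>x. f x - g x) \<in> ratpoly I" if "f \<in> ratpoly I" "g \<in> ratpoly I" for f g
    using ratpoly.add[OF that(1) ratpoly.mult[OF ratpoly.const[of "-1"] that(2)]]
    by (simp add: of_rat_minus)
  then show ?thesis
    using ratpoly.const[of 0 I] ratpoly.const[of 1 I]
    by (simp add: fun_ring_def ratpoly.add ratpoly.mult)
qed

section \<open>Existence of algebraically independent families\<close>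

lemma countable_finitely_supported:
  fixes A :: "'a set" and B :: "'b::zero set"
  assumes "countable A" "countable B"
  shows "countable {P. keys P \<subseteq> A \<and> lookup P ` keys P \<subseteq> B}"
proof -
  let ?g = "\<lambda>P :: 'a \<Rightarrow>\<^sub>0 'b. (\<lambda>k. (k, lookup P k)) ` keys P"
  have "inj ?g"
  proof (rule injI)
    fix P Q :: "'a \<Rightarrow>\<^sub>0 'b" assume eq: "?g P = ?g Q"
    show "P = Q"
    proof (rule poly_mapping_eqI)
      fix k
      have "lookup P k = lookup Q k" if "?g P \<subseteq> ?g Q" "k \<in> keys P" for P Q
        using that by auto
      from this[of P Q] this[of Q P] show "lookup P k = lookup Q k"
        using eq by (metis in_keys_iff order_refl)
    qed
  qed
  moreover have "?g ` {P. keys P \<subseteq> A \<and> lookup P ` keys P \<subseteq> B} \<subseteq> {F. finite F \<and> F \<subseteq> A \<times> B}"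
    by auto
  moreover have "countable {F. finite F \<and> F \<subseteq> A \<times> B}"
    using countable_Collect_finite_subset[of "A \<times> B"] assms by (simp add: conj_commute)
  ultimately show ?thesis
    by (meson countable_image_inj_on countable_subset inj_on_subset subset_UNIV)
qed

lemma countable_rat_mpolys:
  assumes "finite I"
  shows "countable {P :: ('i \<Rightarrow>\<^sub>0 nat) \<Rightarrow>\<^sub>0 rat. \<forall>m\<in>keys P. keys m \<subseteq> I}"
proof -
  have "countable {m :: 'i \<Rightarrow>\<^sub>0 nat. keys m \<subseteq> I \<and> lookup m ` keys m \<subseteq> UNIV}"
    by (rule countable_finitely_supported) (auto intro: countable_finite assms)
  then have "countable {P :: ('i \<Rightarrow>\<^sub>0 nat) \<Rightarrow>\<^sub>0 rat. keys P \<subseteq> {m. keys m \<subseteq> I}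
      \<and> lookup P ` keys P \<subseteq> UNIV}"
    by (intro countable_finitely_supported) auto
  then show ?thesis by (rule countable_subset[rotated]) auto
qed

text \<open>Grouping \<open>P\<close> by powers of the variable \<open>i\<close> gives a univariate
  polynomial whose coefficients are values at \<open>x\<close> of polynomials in the variables
  \<open>I\<close>. One of these is a nonzero polynomial, so by independence its value is nonzero
  and the number of roots is finite.\<close>

lemma finite_roots_fun_upd:
  assumes x: "alg_independent_over_rat I x" and P: "\<forall>m\<in>keys P. keys m \<subseteq> insert i I" "P \<noteq> 0"
  shows "finite {y. rat_mpoly_eval (x(i := y)) P = 0}"
proof -
  define r where "r m = m - Poly_Mapping.single i (lookup m i)" for m :: "'a \<Rightarrow>\<^sub>0 nat"
  have m_eq: "m = r m + Poly_Mapping.single i (lookup m i)" for m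
    by (rule poly_mapping_eqI)
      (simp add: r_def lookup_add lookup_minus lookup_single when_def)
  have r_i: "i \<notin> keys (r m)" for m
    by (simp add: in_keys_iff r_def lookup_minus)
  have r_keys: "keys (r m) \<subseteq> I" if "m \<in> keys P" for m
  proof -
    have "keys (r m) \<subseteq> keys m" by (auto simp: in_keys_iff r_def lookup_minus)
    then show ?thesis using P(1) that r_i by blast
  qed
  \<comment> \<open>\<open>r m\<close> is \<open>m\<close> with the variable \<open>i\<close>
    deleted, so \<open>Q n\<close> is the formal coefficient of the \<open>n\<close>-th power of
    that variable.\<close>
  define Q where "Q n = (\<Sum>m | m \<in> keys P \<and> lookup m i
      = n. Poly_Mapping.single (r m) (lookup P m))" for n
  have mono: "monomial_eval (x(i := y)) m = y ^ lookup m i * monomial_eval x (r m)" for y m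
  proof -
    have "monomial_eval (x(i := y)) (r m) = monomial_eval x (r m)"
      unfolding monomial_eval_def using r_i by (intro prod.cong) auto
    moreover have "monomial_eval (x(i := y)) (Poly_Mapping.single i (lookup m i)) = y ^ lookup m i"
      by (subst monomial_eval_superset[of "{i}"]) (auto split: if_splits)
    ultimately have "monomial_eval (x(i := y)) (r m + Poly_Mapping.single i (lookup m i))
        = y ^ lookup m i * monomial_eval x (r m)"
      by (simp only: monomial_eval_add mult.commute)
    then show ?thesis by (simp only: m_eq[symmetric])
  qed
  define N where "N = (\<lambda>m. lookup m i) ` keys P"
  define p where "p = (\<Sum>n\<in>N. Polynomial.monom (rat_mpoly_eval x (Q n)) n)"
  have evQ: "rat_mpoly_eval x (Q n) = (\<Sum>m | m \<in> keys P \<and> lookup m i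
      = n. of_rat (lookup P m) * monomial_eval x (r m))" for n
    by (simp add: Q_def rat_mpoly_eval_sum rat_mpoly_eval_single)
  have "rat_mpoly_eval (x(i := y)) P = poly p y" for y
  proof -
    have "rat_mpoly_eval (x(i := y)) P = (\<Sum>m\<in>keys P. of_rat (lookup P m) * monomial_eval x (r m)
        * y ^ lookup m i)"
      by (subst rat_mpoly_eval_superset[of "keys P"]) (simp_all add: mono mult_ac)
    also have "\<dots> = (\<Sum>n\<in>N. \<Sum>m | m \<in> keys P \<and> lookup m i = n.
        of_rat (lookup P m) * monomial_eval x (r m) * y ^ lookup m i)"
      unfolding N_def by (rule sum.group[symmetric]) auto
    also have "\<dots> = (\<Sum>n\<in>N. rat_mpoly_eval x (Q n) * y ^ n)"
      unfolding evQ sum_distrib_right by (intro sum.cong) auto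
    also have "\<dots> = poly p y" by (simp add: p_def poly_sum poly_monom)
    finally show ?thesis .
  qed
  moreover have "p \<noteq> 0"
  proof -
    obtain m0 where m0: "m0 \<in> keys P" using P(2) by (metis keys_eq_empty ex_in_conv)
    let ?n = "lookup m0 i"
    \<comment> \<open>No cancellation can occur: monomials with the same exponent at
      \<open>i\<close> and the same remaining part are equal.\<close>
    have "lookup (Q ?n) (r m0) = (\<Sum>m | m \<in> keys P \<and> lookup m i = ?n. if m
        = m0 then lookup P m else 0)"
      unfolding Q_def lookup_sum
    proof (intro sum.cong refl)
      fix m assume "m \<in> {m \<in> keys P. lookup m i = ?n}"
      then have "lookup m i = ?n" by simp
      then have "r m = r m0 \<longleftrightarrow> m = m0" using m_eq[of m] m_eq[of m0] by metis
      then show "lookup (Poly_Mapping.single (r m) (lookup P m)) (r m0) = (if m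
          = m0 then lookup P m else 0)"
        by (simp add: lookup_single when_def)
    qed
    also have "\<dots> = lookup P m0" using m0 by simp
    finally have "Q ?n \<noteq> 0" using m0 by (auto simp: in_keys_iff)
    moreover have "keys m \<subseteq> I" if "m \<in> keys (Q ?n)" for m
    proof -
      have "lookup (Q ?n) m \<noteq> 0" using that by (simp add: in_keys_iff)
      then obtain m' where "m' \<in> keys P" "lookup (Poly_Mapping.single (r m') (lookup P m')) m \<noteq> 0"
        unfolding Q_def lookup_sum by (elim sum.not_neutral_contains_not_neutral) blast
      then show ?thesis using r_keys by (auto simp: lookup_single when_def split: if_splits)
    qed
    ultimately have "rat_mpoly_eval x (Q ?n) \<noteq> 0"
      using x by (auto simp: alg_independent_over_rat_def)
    moreover have "coeff p ?n = rat_mpoly_eval x (Q ?n)"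
      using m0 by (simp add: p_def coeff_sum N_def)
    ultimately show ?thesis by auto
  qed
  ultimately show ?thesis by (simp add: poly_roots_finite)
qed

text \<open>Coordinates are chosen one at a time. Each of countably many nonzero polynomials
  excludes finitely many values, and the reals are uncountable.\<close>

lemma alg_independent_exists:
  fixes I :: "'a set"
  assumes "finite I"
  shows "\<exists>x. alg_independent_over_rat I x"
  using assms
proof induction
  case empty
  have "P = 0" if "\<forall>m\<in>keys P. keys m \<subseteq> {}" "rat_mpoly_eval x P = 0"
    for P and x :: "'a \<Rightarrow> real"
  proof -
    have sub: "keys P \<subseteq> {0}" using that(1) by auto
    then have "lookup P 0 = 0"
      using that(2) rat_mpoly_eval_superset[OF _ sub, of x] by (simp add: monomial_eval_def)
    then show ?thesis using sub by (intro poly_mapping_eqI) (auto simp: in_keys_iff)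
  qed
  then show ?case unfolding alg_independent_over_rat_def by blast
next
  case (insert i I)
  then obtain x where x: "alg_independent_over_rat I x" by blast
  let ?PP = "{P :: ('a \<Rightarrow>\<^sub>0 nat) \<Rightarrow>\<^sub>0 rat. \<forall>m\<in>keys P. keys m \<subseteq> insert i I}"
  define B where "B = (\<Union>P\<in>?PP - {0}. {y. rat_mpoly_eval (x(i := y)) P = 0})"
  have "countable B"
    unfolding B_def
  proof (rule countable_UN)
    show "countable (?PP - {0})"
      using countable_rat_mpolys[of "insert i I"] insert.hyps(1) by (simp add: countable_Diff)
    show "countable {y. rat_mpoly_eval (x(i := y)) P = 0}" if "P \<in> ?PP - {0}" for P
      using finite_roots_fun_upd[OF x] that by (intro countable_finite) simp
  qed
  then have "B \<noteq> UNIV" using uncountable_UNIV_real by blast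
  then obtain y where "y \<notin> B" by blast
  then have "alg_independent_over_rat (insert i I) (x(i := y))"
    unfolding alg_independent_over_rat_def B_def by blast
  then show ?case by (rule exI[of _ "x(i := y)"])
qed

section \<open>Solving \<open>m = x + s X(m)\<close> by iteration\<close>

text \<open>Fixed-point iteration: on the unit box around \<open>x\<close> the field is bounded and
  Lipschitz, so for small \<open>s\<close> the right-hand side preserves the box and contracts by
  1/2 in the sum norm. The iterates are continuous in \<open>s\<close> and converge
  uniformly.\<close>

lemma implicit_curve:
  fixes X :: "('i \<Rightarrow> real) \<Rightarrow> 'i \<Rightarrow> real"
  assumes I: "finite I" and X: "\<And>i. i \<in> I \<Longrightarrow> (\<lambda>q. X q i) \<in> ratpoly I"
  obtains \<delta> m where "\<delta> > 0" "\<And>i. i \<in> I \<Longrightarrow> continuous_on {0..\<delta>} (\<lambda>s. m s i)"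
    "\<And>s i. s \<in> {0..\<delta>} \<Longrightarrow> i \<in> I \<Longrightarrow> m s i = x i + s * X (m s) i"
proof -
  \<comment> \<open>\<open>M\<close> bounds the coordinates of every point of the unit box around
    \<open>x\<close>.\<close>
  define M where "M = 1 + (\<Sum>i\<in>I. \<bar>x i\<bar>)"
  have "\<forall>i\<in>I. \<exists>K\<ge>0. \<forall>y z. (\<forall>i\<in>I. \<bar>y i\<bar> \<le> M \<and> \<bar>z i\<bar> \<le> M) \<longrightarrow>
           \<bar>X y i\<bar> \<le> K \<and> \<bar>X y i - X z i\<bar> \<le> K * (\<Sum>i\<in>I. \<bar>y i - z i\<bar>)"
    by (intro ballI ratpoly_lipschitz[OF _ I] X)
  from bchoice[OF this] obtain K where K: "\<forall>i\<in>I. K i \<ge> 0 \<and> (\<forall>y z. (\<forall>i\<in>I. \<bar>y i\<bar> \<le> M \<and> \<bar>z i\<bar> \<le> M) \<longrightarrow>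
           \<bar>X y i\<bar> \<le> K i \<and> \<bar>X y i - X z i\<bar> \<le> K i * (\<Sum>i\<in>I. \<bar>y i - z i\<bar>))" ..
  define L where "L = 1 + (\<Sum>i\<in>I. K i)"
  define n where "n = real (card I)"
  \<comment> \<open>Chosen so that \<open>\<delta> * L \<le> 1\<close>, which keeps iterates in the
    box, and \<open>n * (\<delta> * L) \<le> 1/2\<close>, which gives the contraction. The
    \<open>n + 1\<close> covers empty \<open>I\<close>.\<close>
  define \<delta> where "\<delta> = 1 / (2 * L * (n + 1))"
  have K0: "K i \<ge> 0" if "i \<in> I" for i using K that by blast
  have L1: "L \<ge> 1" using K0 by (simp add: L_def sum_nonneg)
  have KL: "K i \<le> L" if "i \<in> I" for i
    using member_le_sum[of i I K] K0 that I by (simp add: L_def)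
  have n0: "n \<ge> 0" by (simp add: n_def)
  have \<delta>0: "\<delta> > 0" using L1 n0 by (simp add: \<delta>_def)
  have \<delta>eq: "n * (\<delta> * L) = (1/2) * (n / (n + 1))" "\<delta> * L = (1/2) * (1 / (n + 1))"
    using L1 n0 by (simp_all add: \<delta>_def divide_simps)
  have \<delta>n: "n * (\<delta> * L) \<le> 1/2" and \<delta>L: "\<delta> * L \<le> 1"
    unfolding \<delta>eq using n0 by (simp_all add: divide_simps)
  have XL: "\<bar>X y i\<bar> \<le> L" "\<bar>X y i - X z i\<bar> \<le> L * (\<Sum>i\<in>I. \<bar>y i - z i\<bar>)"
    if "i \<in> I" "\<forall>i\<in>I. \<bar>y i - x i\<bar> \<le> 1" "\<forall>i\<in>I. \<bar>z i - x i\<bar> \<le> 1" for y z i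
  proof -
    have b: "\<bar>y j\<bar> \<le> M" if "j \<in> I" "\<bar>y j - x j\<bar> \<le> 1" for y :: "'i \<Rightarrow> real" and j
      using member_le_sum[of j I "\<lambda>i. \<bar>x i\<bar>"] that I by (simp add: M_def)
    have "\<forall>i\<in>I. \<bar>y i\<bar> \<le> M \<and> \<bar>z i\<bar> \<le> M" using b that(2,3) by blast
    then have *: "\<bar>X y i\<bar> \<le> K i" "\<bar>X y i - X z i\<bar> \<le> K i * (\<Sum>i\<in>I. \<bar>y i - z i\<bar>)"
      using K that(1) by blast+
    show "\<bar>X y i\<bar> \<le> L" using *(1) KL[OF that(1)] by linarith
    have "K i * (\<Sum>i\<in>I. \<bar>y i - z i\<bar>) \<le> L * (\<Sum>i\<in>I. \<bar>y i - z i\<bar>)"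
      by (intro mult_right_mono KL that(1) sum_nonneg abs_ge_zero)
    with *(2) show "\<bar>X y i - X z i\<bar> \<le> L * (\<Sum>i\<in>I. \<bar>y i - z i\<bar>)" by linarith
  qed
  define mm where "mm k s = ((\<lambda>y i. x i + s * X y i) ^^ k) x" for k and s :: real
  have mm0: "mm 0 s = x" and mmS: "mm (Suc k) s i = x i + s * X (mm k s) i" for k s i
    by (simp_all add: mm_def)
  have box: "\<forall>i\<in>I. \<bar>mm k s i - x i\<bar> \<le> 1" if "s \<in> {0..\<delta>}" for k s
  proof (induction k)
    case 0 show ?case by (simp add: mm0)
  next
    case (Suc k)
    show ?case
    proof
      fix i assume "i \<in> I"
      then have "\<bar>s * X (mm k s) i\<bar> \<le> \<delta> * L"
        unfolding abs_mult using XL(1)[OF _ Suc Suc] that \<delta>0 by (intro mult_mono) auto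
      then show "\<bar>mm (Suc k) s i - x i\<bar> \<le> 1" using \<delta>L by (simp add: mmS)
    qed
  qed
  have D: "(\<Sum>i\<in>I. \<bar>mm (Suc k) s i - mm k s i\<bar>) \<le> (1/2) ^ k" if s: "s \<in> {0..\<delta>}" for k s
  proof (induction k)
    case 0
    have "(\<Sum>i\<in>I. \<bar>mm (Suc 0) s i - mm 0 s i\<bar>) \<le> of_nat (card I) * (\<delta> * L)"
    proof (rule sum_bounded_above)
      fix i assume "i \<in> I"
      then have "\<bar>s * X x i\<bar> \<le> \<delta> * L"
        unfolding abs_mult using XL(1)[of i x x] s \<delta>0 by (intro mult_mono) auto
      then show "\<bar>mm (Suc 0) s i - mm 0 s i\<bar> \<le> \<delta> * L" by (simp add: mmS mm0)
    qed
    then show ?case using \<delta>n by (simp add: n_def)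
  next
    case (Suc k)
    let ?D = "\<Sum>i\<in>I. \<bar>mm (Suc k) s i - mm k s i\<bar>"
    have "(\<Sum>i\<in>I. \<bar>mm (Suc (Suc k)) s i - mm (Suc k) s i\<bar>) \<le> of_nat (card I) * (\<delta> * (L * ?D))"
    proof (rule sum_bounded_above)
      fix i assume "i \<in> I"
      then have "\<bar>s * (X (mm (Suc k) s) i - X (mm k s) i)\<bar> \<le> \<delta> * (L * ?D)"
        unfolding abs_mult using XL(2)[OF _ box[OF s] box[OF s]] s \<delta>0 by (intro mult_mono) auto
      moreover have "mm (Suc (Suc k)) s i - mm (Suc k) s i = s * (X (mm (Suc k) s) i - X (mm k s) i)"
        unfolding mmS[of "Suc k"] mmS[of k s i] by (simp add: right_diff_distrib)
      ultimately show "\<bar>mm (Suc (Suc k)) s i - mm (Suc k) s i\<bar> \<le> \<delta> * (L * ?D)" by (simp only:)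
    qed
    also have "\<dots> = n * (\<delta> * L) * ?D" by (simp add: n_def)
    also have "\<dots> \<le> 1/2 * (1/2) ^ k"
      using Suc \<delta>n by (intro mult_mono) (auto intro: sum_nonneg)
    finally show ?case by simp
  qed
  define m where "m s i = lim (\<lambda>k. mm k s i)" for s i
  have unif: "uniform_limit {0..\<delta>} (\<lambda>k s. mm k s i) (\<lambda>s. m s i) sequentially" if i: "i \<in> I" for i
  proof -
    have "uniformly_convergent_on {0..\<delta>} (\<lambda>N s. \<Sum>k<N. mm (Suc k) s i - mm k s i)"
    proof (rule Weierstrass_m_test'[where M = "\<lambda>k. (1/2) ^ k"])
      fix k s assume s: "s \<in> {0..\<delta>}"
      have "\<bar>mm (Suc k) s i - mm k s i\<bar> \<le> (\<Sum>i\<in>I. \<bar>mm (Suc k) s i - mm k s i\<bar>)"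
        using I i by (intro member_le_sum) auto
      then show "norm (mm (Suc k) s i - mm k s i) \<le> (1/2) ^ k" using D[OF s, of k] by simp
    qed simp
    moreover have "(\<Sum>k<N. mm (Suc k) s i - mm k s i) = mm N s i - x i" for N s
      using sum_lessThan_telescope[of "\<lambda>k. mm k s i" N] by (simp add: mm0)
    ultimately obtain l where l: "uniform_limit {0..\<delta>} (\<lambda>N s. mm N s i - x i) l sequentially"
      by (auto simp: uniformly_convergent_on_def)
    then have l': "uniform_limit {0..\<delta>} (\<lambda>N s. (mm N s i - x i) + x i) (\<lambda>s. l s + x i) sequentially"
      by (intro uniform_limit_add uniform_limit_const)
    have "m s i = l s + x i" if "s \<in> {0..\<delta>}" for s
      unfolding m_def using tendsto_uniform_limitI[OF l' that] by (intro limI) simp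
    then show ?thesis
      using uniform_limit_cong'[of "{0..\<delta>}" "\<lambda>N s. (mm N s i - x i) + x i" "\<lambda>N s. mm N s i"
          "\<lambda>s. l s + x i" "\<lambda>s. m s i"] l' by simp
  qed
  have cont_mm: "\<forall>i\<in>I. continuous_on {0..\<delta>} (\<lambda>s. mm k s i)" for k
  proof (induction k)
    case 0 show ?case by (simp add: mm0)
  next
    case (Suc k)
    then have "continuous_on {0..\<delta>} (\<lambda>s. X (mm k s) i)" if "i \<in> I" for i
      using that by (intro ratpoly_continuous_on[OF X]) auto
    then show ?case unfolding mmS by (auto intro!: continuous_intros)
  qed
  show thesis
  proof
    show "\<delta> > 0" by (fact \<delta>0)
    show "continuous_on {0..\<delta>} (\<lambda>s. m s i)" if "i \<in> I" for i
      using cont_mm that by (intro uniform_limit_theorem[OF _ unif[OF that]]) auto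
    show "m s i = x i + s * X (m s) i" if s: "s \<in> {0..\<delta>}" and i: "i \<in> I" for s i
    proof -
      have lim: "(\<lambda>k. mm k s i) \<longlonglongrightarrow> m s i" if "i \<in> I" for i
        using tendsto_uniform_limitI[OF unif[OF that] s] .
      have "(\<lambda>k. X (mm k s) i) \<longlonglongrightarrow> X (m s) i"
        by (rule ratpoly_tendsto[OF X[OF i] lim])
      then have "(\<lambda>k. mm (Suc k) s i) \<longlonglongrightarrow> x i + s * X (m s) i"
        unfolding mmS by (intro tendsto_intros)
      moreover have "(\<lambda>k. mm (Suc k) s i) \<longlonglongrightarrow> m s i"
        by (rule LIMSEQ_Suc[OF lim[OF i]])
      ultimately show ?thesis by (rule LIMSEQ_unique[rotated])
    qed
  qed
qed

section \<open>Edge rows and trivial motions\<close>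

text \<open>A row of the rigidity matrix: its inner product with a velocity field is half the rate
  of change of the squared length of \<open>u v\<close>.\<close>

definition edge_row :: "'v \<Rightarrow> 'v \<Rightarrow> ('v \<times> 'd \<Rightarrow> real) \<Rightarrow> 'v \<times> 'd \<Rightarrow> real" where
  "edge_row u v x = (\<lambda>(w, k).
     ((if w = u then 1 else 0) - (if w = v then 1 else 0)) * (x (u, k) - x (v, k)))"

text \<open>\<open>None\<close> gives the translations, \<open>Some b\<close> the infinitesimal
  rotations in the plane of the axes \<open>a\<close> and \<open>b\<close>. Both orders of the axes
  and the zero row for \<open>a = b\<close> occur; only the span matters.\<close>

fun trivial_row :: "'d option \<times> 'd \<Rightarrow> ('v \<times> 'd \<Rightarrow> real) \<Rightarrow> 'v \<times> 'd \<Rightarrow> real" where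
  "trivial_row (None, a) x (w, k) = (if k = a then 1 else 0)"
| "trivial_row (Some b, a) x (w, k) = (if k = a then x (w, b) else 0) - (if k
    = b then x (w, a) else 0)"

abbreviation edge_rows :: "('v \<times> 'v) set \<Rightarrow> (('v \<times> 'd \<Rightarrow> real) \<Rightarrow> 'v \<times> 'd \<Rightarrow> real) set" where
  "edge_rows P \<equiv> (\<lambda>(u, v). edge_row u v) ` P"

abbreviation trivial_rows :: "(('v \<times> 'd \<Rightarrow> real) \<Rightarrow> 'v \<times> 'd \<Rightarrow> real) set" where
  "trivial_rows \<equiv> range trivial_row"

lemma ip_diff_row:
  fixes c :: "'d::finite \<Rightarrow> real"
  assumes "finite V" "u \<in> V" "v \<in> V"
  shows "ip (V \<times> UNIV) (\<lambda>(w, k). ((if w = u then 1 else 0) - (if w = v then 1 else 0)) * c k) y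
    = (\<Sum>k\<in>UNIV. c k * (y (u, k) - y (v, k)))"
proof -
  have "ip (V \<times> UNIV) (\<lambda>(w, k). ((if w = u then 1 else 0) - (if w = v then 1 else 0)) * c k) y
      = (\<Sum>k\<in>UNIV. \<Sum>w\<in>V. ((if w = u then 1 else 0) - (if w = v then 1 else 0)) * c k * y (w, k))"
    unfolding ip_def by (subst sum.swap) (simp add: sum.cartesian_product case_prod_unfold)
  also have "\<dots> = (\<Sum>k\<in>UNIV. (\<Sum>w\<in>V. if w = u then c k * y (w, k) else 0) - (\<Sum>w\<in>V. if w
      = v then c k * y (w, k) else 0))"
    unfolding sum_subtractf[symmetric] by (intro sum.cong refl) (simp add: left_diff_distrib)
  also have "\<dots> = (\<Sum>k\<in>UNIV. c k * (y (u, k) - y (v, k)))"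
    using assms by (simp add: right_diff_distrib)
  finally show ?thesis .
qed

lemma ip_edge_row:
  fixes x y :: "'v \<times> 'd::finite \<Rightarrow> real"
  assumes "finite V" "u \<in> V" "v \<in> V"
  shows "ip (V \<times> UNIV) (edge_row u v x) y = (\<Sum>k\<in>UNIV. (x (u, k) - x (v, k)) * (y (u, k) - y (v, k)))"
  unfolding edge_row_def by (rule ip_diff_row[OF assms])

lemma ip_edge_trivial:
  fixes x :: "'v \<times> 'd::finite \<Rightarrow> real"
  assumes "finite V" "u \<in> V" "v \<in> V"
  shows "ip (V \<times> UNIV) (edge_row u v x) (trivial_row j x) = 0"
proof (cases j)
  case (Pair o' a)
  show ?thesis
  proof (cases o')
    case None
    then show ?thesis using Pair by (simp add: ip_edge_row[OF assms])
  next
    case (Some b)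
    let ?D = "\<lambda>k. x (u, k) - x (v, k)"
    have "ip (V \<times> UNIV) (edge_row u v x) (trivial_row j x)
        = (\<Sum>k\<in>UNIV. (if k = a then ?D a * ?D b else 0) - (if k = b then ?D a * ?D b else 0))"
      unfolding ip_edge_row[OF assms] Pair Some by (intro sum.cong refl) (simp add: algebra_simps)
    also have "\<dots> = 0" by (simp add: sum_subtractf)
    finally show ?thesis .
  qed
qed

section \<open>Rows with polynomial entries and full rank at generic configurations\<close>

definition poly_rows :: "'i set \<Rightarrow> (('j \<Rightarrow> real) \<Rightarrow> 'i \<Rightarrow> real) set \<Rightarrow> 'j set \<Rightarrow> bool" where
  "poly_rows I R J \<longleftrightarrow> (\<forall>r\<in>R. \<forall>i\<in>I. (\<lambda>x. r x i) \<in> ratpoly J)"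

lemma gram_in_poly_rows: "poly_rows I R J \<Longrightarrow> gram_in (ratpoly J) I R"
  unfolding gram_in_def poly_rows_def by (intro ballI fun_ring_ip[OF fun_ring_ratpoly]) blast+

lemma poly_rows_edge_rows: "P \<subseteq> V \<times> V \<Longrightarrow> poly_rows (W \<times> UNIV) (edge_rows P) (V \<times> UNIV)"
  unfolding poly_rows_def edge_row_def
  by (auto intro!: fun_ringD[OF fun_ring_ratpoly] ratpoly.var ratpoly.const)

lemma poly_rows_trivial_rows:
  fixes V :: "'v set"
  shows "poly_rows (V \<times> (UNIV :: 'd set)) trivial_rows (V \<times> UNIV)"
proof -
  have *: "(\<lambda>x. if c then x (w, b) else 0) \<in> ratpoly (V \<times> (UNIV :: 'd set))" if "w \<in> V" for c b w
    using that by (cases c) (auto intro: ratpoly.var fun_ringD(1)[OF fun_ring_ratpoly])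
  have "(\<lambda>x. trivial_row (o', a) x (w, k)) \<in> ratpoly (V \<times> (UNIV :: 'd set))" if "w \<in> V" for o' a k w
  proof (cases o')
    case None
    then show ?thesis by (simp add: fun_ringD(1,2)[OF fun_ring_ratpoly])
  next
    case (Some b)
    show ?thesis unfolding Some trivial_row.simps
      by (intro fun_ringD(4)[OF fun_ring_ratpoly] * that)
  qed
  then show ?thesis unfolding poly_rows_def by auto
qed

lemma poly_rows_Un: "poly_rows I R J \<Longrightarrow> poly_rows I R' J \<Longrightarrow> poly_rows I (R \<union> R') J"
  unfolding poly_rows_def by blast

text \<open>The polynomial \<open>N\<close> of \<open>ker_zero_open\<close> is nonzero at
  \<open>x0\<close>, hence nonzero at the generic \<open>x\<close>.\<close>

lemma ker_zero_generic:
  assumes "poly_rows I R J" "finite R" "finite I" "ker_zero I R x0" "alg_independent_over_rat J x"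
  shows "ker_zero I R x"
proof -
  obtain N where N: "N \<in> ratpoly J" "N x0 \<noteq> 0" "\<forall>x. N x \<noteq> 0 \<longrightarrow> ker_zero I R x"
    using ker_zero_open[OF fun_ring_ratpoly gram_in_poly_rows[OF assms(1)] assms(2-4)] by blast
  then show ?thesis using generic_zero[OF assms(5) N(1)] by blast
qed

text \<open>Triviality of a motion is expressed by its effect on all pairs instead of by membership
  in the span of \<open>trivial_rows\<close>; \<open>ker_zero\<close> with the trivial rows added is
  the rank form.\<close>

definition inf_rigid :: "'v set \<Rightarrow> ('v \<times> 'v) set \<Rightarrow> ('v \<times> 'd \<Rightarrow> real) \<Rightarrow> bool" where
  "inf_rigid V P x \<longleftrightarrow> (\<forall>w. (\<forall>(a, b)\<in>P. ip (V \<times> UNIV) w (edge_row a b x) = 0) \<longrightarrow>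
     (\<forall>a\<in>V. \<forall>b\<in>V. ip (V \<times> UNIV) w (edge_row a b x) = 0))"

text \<open>Subtract from \<open>w\<close> its projection onto the trivial motions. The remainder is
  orthogonal to the trivial rows and, by \<open>ip_edge_trivial\<close>, still to the edge rows, so
  it vanishes.\<close>

lemma motion_trivial:
  fixes x :: "'v \<times> 'd::finite \<Rightarrow> real"
  assumes V: "finite V" and P: "P \<subseteq> V \<times> V" and K: "ker_zero (V \<times> UNIV) (edge_rows P \<union> trivial_rows) x"
    and w: "\<forall>(a, b)\<in>P. ip (V \<times> UNIV) w (edge_row a b x) = 0"
  shows "\<exists>c. \<forall>i\<in>V \<times> UNIV. w i = (\<Sum>j\<in>UNIV. c j * trivial_row j x i)"
proof -
  let ?I = "V \<times> (UNIV :: 'd set)"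
  have I: "finite ?I" using V by simp
  obtain c where c: "\<forall>j\<in>UNIV. ip ?I (\<lambda>i. w i - (\<Sum>j\<in>UNIV. c j
      * trivial_row j x i)) (trivial_row j x) = 0"
    using orth_projection[OF I, where w = w and t = "\<lambda>j. trivial_row j x" and J = UNIV] by auto
  define y where "y = (\<lambda>i. w i - (\<Sum>j\<in>UNIV. c j * trivial_row j x i))"
  have "ip ?I y (r x) = 0"
    if "r \<in> edge_rows P \<union> trivial_rows" for r
    using that
  proof
    assume "r \<in> edge_rows P"
    then obtain a b where ab: "(a, b) \<in> P" "r = edge_row a b" by auto
    then have "a \<in> V" "b \<in> V" using P by auto
    note t = ip_edge_trivial[OF V this, of x]
    show ?thesis unfolding y_def ip_diff_left ip_comb_left ab
      using bspec[OF w ab(1)] t by (simp add: ip_commute[of ?I "trivial_row _ x"])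
  qed (use c in \<open>auto simp: y_def\<close>)
  then have "\<forall>i\<in>?I. y i = 0"
    using K unfolding ker_zero_def by blast
  then have "\<forall>i\<in>?I. w i = (\<Sum>j\<in>UNIV. c j * trivial_row j x i)" by (simp add: y_def)
  then show ?thesis by (rule exI[of _ c])
qed

lemma ker_zero_imp_inf_rigid:
  fixes x :: "'v \<times> 'd::finite \<Rightarrow> real"
  assumes V: "finite V" and P: "P \<subseteq> V \<times> V" and K: "ker_zero (V \<times> UNIV) (edge_rows P \<union> trivial_rows) x"
  shows "inf_rigid V P x"
  unfolding inf_rigid_def
proof (intro allI impI ballI)
  fix w :: "'v \<times> 'd \<Rightarrow> real" and a b
  assume w: "\<forall>(a, b)\<in>P. ip (V \<times> UNIV) w (edge_row a b x) = 0" and ab: "a \<in> V" "b \<in> V"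
  obtain c where "\<forall>i\<in>V \<times> UNIV. w i = (\<Sum>j\<in>UNIV. c j * trivial_row j x i)"
    using motion_trivial[OF V P K w] by blast
  then have c: "w i = (\<Sum>j\<in>UNIV. c j * trivial_row j x i)" if "i \<in> V \<times> UNIV" for i
    using that by (rule bspec)
  have "ip (V \<times> UNIV) w (edge_row a b x)
      = ip (V \<times> UNIV) (edge_row a b x) (\<lambda>i. \<Sum>j\<in>UNIV. c j * trivial_row j x i)"
    by (subst ip_commute) (intro ip_cong refl c)
  also have "\<dots> = 0" unfolding ip_comb_right by (simp add: ip_edge_trivial[OF V ab])
  finally show "ip (V \<times> UNIV) w (edge_row a b x) = 0" .
qed

text \<open>By \<open>ker_zero_generic\<close> one special configuration suffices, and there a
  motion of the complete graph can be written out as a translation plus a skew-symmetric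
  map.\<close>

lemma complete_ker_zero_generic:
  fixes x :: "'v \<times> 'd::finite \<Rightarrow> real"
  assumes V: "finite V" and card: "CARD('d) \<le> card V" and x: "alg_independent_over_rat (V \<times> UNIV) x"
  shows "ker_zero (V \<times> UNIV) (edge_rows (V \<times> V) \<union> trivial_rows) x"
proof -
  let ?I = "V \<times> (UNIV :: 'd set)"
  obtain \<phi> :: "'d \<Rightarrow> 'v" where \<phi>: "inj \<phi>" "range \<phi> \<subseteq> V"
    using card_le_inj[of "UNIV :: 'd set" V] card V by auto
  \<comment> \<open>\<open>CARD('d)\<close> vertices sit at the standard basis vectors, all others
    at the origin.\<close>
  define x0 :: "'v \<times> 'd \<Rightarrow> real" where "x0 = (\<lambda>(v, k). if v = \<phi> k then 1 else 0)"
  have x0: "x0 (v, k) = (if v = \<phi> k then 1 else 0)" for v k by (simp add: x0_def)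
  have \<phi>V: "\<phi> k \<in> V" for k using \<phi>(2) by auto
  have \<phi>eq: "\<phi> i = \<phi> j \<longleftrightarrow> i = j" for i j using \<phi>(1) by (auto dest: injD)
  have "ker_zero ?I (edge_rows (V \<times> V) \<union> trivial_rows) x0"
    unfolding ker_zero_def
  proof (intro allI impI)
    fix w :: "'v \<times> 'd \<Rightarrow> real"
    assume w: "\<forall>r\<in>edge_rows (V \<times> V) \<union> trivial_rows. ip ?I w (r x0) = 0"
    have edge: "(\<Sum>k\<in>UNIV. (x0 (u, k) - x0 (v, k)) * (w (u, k) - w (v, k))) = 0" if "u \<in> V" "v \<in> V"
        for u v
    proof -
      have "edge_row u v \<in> edge_rows (V \<times> V) \<union> trivial_rows" using that by auto
      then have "ip ?I w (edge_row u v x0) = 0" using w by blast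
      then show ?thesis using ip_edge_row[OF V that, of x0 w] by (simp only: ip_commute)
    qed
    have triv: "ip ?I w (trivial_row j x0) = 0" for j using w by blast
    have triv': "ip ?I (trivial_row j x0) w = 0" for j using triv by (simp only: ip_commute)
    \<comment> \<open>Candidates for the translation and the linear part of \<open>w\<close>. Taking
      \<open>b\<close> from the diagonal entries forces \<open>A\<close> to have zero diagonal, as a
      skew matrix must.\<close>
    define b where "b j = w (\<phi> j, j)" for j
    define A where "A j i = w (\<phi> i, j) - b j" for j i
    have skew: "A j i = - A i j" for i j
    proof (cases "i = j")
      case True
      then show ?thesis by (simp add: A_def b_def)
    next
      case False
      have "0 = (\<Sum>k\<in>UNIV. (x0 (\<phi> i, k) - x0 (\<phi> j, k)) * (w (\<phi> i, k) - w (\<phi> j, k)))"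
        using edge[OF \<phi>V \<phi>V] by (rule sym)
      also have "\<dots> = (\<Sum>k\<in>UNIV. (if k = i then w (\<phi> i, i) - w (\<phi> j, i) else 0)
          - (if k = j then w (\<phi> i, j) - w (\<phi> j, j) else 0))"
        by (intro sum.cong refl) (use False in \<open>auto simp: x0 \<phi>eq\<close>)
      also have "\<dots> = w (\<phi> i, i) - w (\<phi> j, i) - (w (\<phi> i, j) - w (\<phi> j, j))"
        by (simp add: sum_subtractf)
      finally show ?thesis by (simp add: A_def b_def)
    qed
    have rest: "w (v, i) = b i" if "v \<in> V" "v \<notin> range \<phi>" for v i
    proof -
      have "(\<Sum>k\<in>UNIV. if k = i then w (\<phi> i, i) - w (v, i) else 0)
          = (\<Sum>k\<in>UNIV. (x0 (\<phi> i, k) - x0 (v, k)) * (w (\<phi> i, k) - w (v, k)))"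
        by (intro sum.cong refl) (use that(2) in \<open>auto simp: x0 \<phi>eq\<close>)
      also have "\<dots> = 0" by (rule edge[OF \<phi>V that(1)])
      finally have "w (\<phi> i, i) - w (v, i) = 0" by simp
      then show ?thesis by (simp add: b_def)
    qed
    have w_eq: "w (v, k) = b k + (\<Sum>l\<in>UNIV. A k l * x0 (v, l))" if "v \<in> V" for v k
    proof (cases "v \<in> range \<phi>")
      case True
      then obtain i where "v = \<phi> i" by auto
      then show ?thesis by (simp add: x0 \<phi>eq A_def if_distrib[of "\<lambda>c. _ * c"] cong: if_cong)
    next
      case False
      then have "x0 (v, l) = 0" for l by (auto simp: x0)
      then show ?thesis using rest[OF that False] by simp
    qed
    \<comment> \<open>\<open>w\<close> rebuilt from trivial rows; the factor 1/2 compensates for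
      each plane occurring in both orders.\<close>
    define z where "z i = (\<Sum>a\<in>UNIV. b a * trivial_row (None, a) x0 i)
        + (\<Sum>a\<in>UNIV. \<Sum>l\<in>UNIV. (A a l / 2) * trivial_row (Some l, a) x0 i)" for i
    have z: "z (v, k) = b k + (\<Sum>l\<in>UNIV. A k l * x0 (v, l))" for v k
    proof -
      have "(\<Sum>a\<in>UNIV. \<Sum>l\<in>UNIV. (A a l / 2) * trivial_row (Some l, a) x0 (v, k))
          = (\<Sum>a\<in>UNIV. \<Sum>l\<in>UNIV. if k = a then A a l / 2 * x0 (v, l) else 0)
            - (\<Sum>a\<in>UNIV. \<Sum>l\<in>UNIV. if k = l then A a l / 2 * x0 (v, a) else 0)"
        unfolding sum_subtractf[symmetric] by (intro sum.cong refl) (simp add: right_diff_distrib)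
      also have "(\<Sum>a\<in>UNIV. \<Sum>l\<in>UNIV. if k = a then A a l / 2 * x0 (v, l) else 0)
          = (\<Sum>l\<in>UNIV. A k l / 2 * x0 (v, l))"
        by (subst sum.swap) simp
      also have "(\<Sum>a\<in>UNIV. \<Sum>l\<in>UNIV. if k = l then A a l / 2 * x0 (v, a) else 0)
          = (\<Sum>l\<in>UNIV. A l k / 2 * x0 (v, l))"
        by simp
      also have "\<dots> = - (\<Sum>l\<in>UNIV. A k l / 2 * x0 (v, l))"
        unfolding sum_negf[symmetric] by (intro sum.cong refl) (subst skew, simp)
      finally show ?thesis
        by (simp add: z_def if_distrib[of "\<lambda>c. _
            * c"] sum.distrib[symmetric] flip: distrib_right cong: if_cong)
    qed
    have "ip ?I w z = 0"
    proof -
      have "ip ?I z w = 0"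
        unfolding z_def[abs_def] ip_add_left ip_comb_left ip_sum_left triv' by simp
      then show ?thesis by (simp only: ip_commute)
    qed
    \<comment> \<open>\<open>w\<close> is both a combination of trivial rows and orthogonal to them,
      so its norm is zero.\<close>
    moreover have "ip ?I w z = ip ?I w w" by (rule ip_cong) (auto simp: z w_eq)
    ultimately show "\<forall>i\<in>?I. w i = 0" using V by (simp add: ip_self_eq_0_iff)
  qed
  from ker_zero_generic[OF _ _ _ this x] show ?thesis
    using V by (simp add: poly_rows_Un poly_rows_edge_rows poly_rows_trivial_rows)
qed

section \<open>Infinitesimal rigidity at generic configurations\<close>

definition sqd :: "('v \<times> 'd::finite \<Rightarrow> real) \<Rightarrow> 'v \<Rightarrow> 'v \<Rightarrow> real" where
  "sqd x u v = (\<Sum>k\<in>UNIV. (x (u, k) - x (v, k))\<^sup>2)"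

text \<open>Needed to follow a motion: a certificate of nondegeneracy in this class keeps its value
  at every configuration with the same distances, generic or not.\<close>

definition dist_invariant :: "'v set \<Rightarrow> (('v \<times> 'd::finite \<Rightarrow> real) \<Rightarrow> real) set" where
  "dist_invariant V = {f. \<forall>x y. (\<forall>u\<in>V. \<forall>v\<in>V. sqd x u v = sqd y u v) \<longrightarrow> f x = f y}"

lemma fun_ring_Int: "fun_ring F \<Longrightarrow> fun_ring G \<Longrightarrow> fun_ring (F \<inter> G)"
  unfolding fun_ring_def by simp

lemma fun_ring_dist_invariant:
  fixes I :: "('v \<times> 'd::finite) set"
  shows "fun_ring (ratpoly I \<inter> dist_invariant V)"
proof (rule fun_ring_Int[OF fun_ring_ratpoly])
  have "(\<lambda>x. f x + g x) \<in> dist_invariant V" "(\<lambda>x. f x - g x) \<in> dist_invariant V"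
    "(\<lambda>x. f x * g x) \<in> dist_invariant V"
    if f: "f \<in> dist_invariant V" and g: "g \<in> dist_invariant V" for f g :: "('v \<times> 'd \<Rightarrow> real) \<Rightarrow> real"
  proof -
    have "f x = f y \<and> g x = g y" if "\<forall>u\<in>V. \<forall>v\<in>V. sqd x u v = sqd y u v" for x y
      using f g that unfolding dist_invariant_def by blast
    then show "(\<lambda>x. f x + g x) \<in> dist_invariant V" "(\<lambda>x. f x - g x) \<in> dist_invariant V"
      "(\<lambda>x. f x * g x) \<in> dist_invariant V"
      unfolding dist_invariant_def by (intro CollectI allI impI; metis)+
  qed
  moreover have "(\<lambda>_ :: 'v \<times> 'd \<Rightarrow> real. 0) \<in> dist_invariant V"
      "(\<lambda>_ :: 'v \<times> 'd \<Rightarrow> real. 1) \<in> dist_invariant V"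
    by (simp_all add: dist_invariant_def)
  ultimately show "fun_ring (dist_invariant V :: (('v \<times> 'd \<Rightarrow> real) \<Rightarrow> real) set)"
    unfolding fun_ring_def by simp
qed

text \<open>Polarization: the Gram matrix of the edge rows is a function of the distances.\<close>

lemma ip_edge_row_edge_row:
  fixes x :: "'v \<times> 'd::finite \<Rightarrow> real"
  assumes "finite V" "a \<in> V" "b \<in> V"
  shows "ip (V \<times> UNIV) (edge_row a b x) (edge_row c d x) =
    ((if a = c then 1 else 0) - (if a = d then 1 else 0) - (if b = c then 1 else 0) + (if b
        = d then 1 else 0)) *
    ((sqd x a d + sqd x b c - sqd x a c - sqd x b d) / 2)"
proof -
  define t :: real where "t = (if a = c then 1 else 0) - (if a = d then 1 else 0) - (if b
      = c then 1 else 0) + (if b = d then 1 else 0)"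
  have "(\<Sum>k\<in>UNIV. 2 * ((x (a, k) - x (b, k)) * (x (c, k) - x (d, k))))
      = sqd x a d + sqd x b c - sqd x a c - sqd x b d"
    unfolding sqd_def sum.distrib[symmetric] sum_subtractf[symmetric]
    by (intro sum.cong refl) (simp add: power2_eq_square algebra_simps)
  then have *: "(\<Sum>k\<in>UNIV. (x (a, k) - x (b, k)) * (x (c, k) - x (d, k)))
      = (sqd x a d + sqd x b c - sqd x a c - sqd x b d) / 2"
    unfolding sum_distrib_left[symmetric] by simp
  have "ip (V \<times> UNIV) (edge_row a b x) (edge_row c d x)
      = (\<Sum>k\<in>UNIV. t * ((x (a, k) - x (b, k)) * (x (c, k) - x (d, k))))"
    unfolding ip_edge_row[OF assms] by (intro sum.cong refl) (simp add: edge_row_def t_def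
        algebra_simps)
  also have "\<dots> = t * ((sqd x a d + sqd x b c - sqd x a c - sqd x b d) / 2)"
    unfolding * sum_distrib_left[symmetric] ..
  finally show ?thesis unfolding t_def .
qed

lemma gram_in_dist_invariant:
  assumes "finite V" "P \<subseteq> V \<times> V"
  shows "gram_in (ratpoly (V \<times> (UNIV :: 'd::finite set)) \<inter> dist_invariant V) (V \<times> UNIV) (edge_rows P)"
proof -
  have "(\<lambda>x. ip (V \<times> UNIV) (edge_row a b x) (edge_row c d x)) \<in> ratpoly (V \<times> (UNIV :: 'd set)) \<inter>
      dist_invariant V"
    if "(a, b) \<in> P" "(c, d) \<in> P" for a b c d
  proof
    show "(\<lambda>x. ip (V \<times> UNIV) (edge_row a b x) (edge_row c d x)) \<in> ratpoly (V \<times> (UNIV :: 'd set))"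
      using gram_in_poly_rows[OF poly_rows_edge_rows[OF assms(2)], of V] that unfolding
          gram_in_def by force
    have "a \<in> V" "b \<in> V" "c \<in> V" "d \<in> V" using that assms(2) by auto
    then show "(\<lambda>x. ip (V \<times> UNIV) (edge_row a b x) (edge_row c d x)) \<in> dist_invariant V"
      unfolding dist_invariant_def mem_Collect_eq ip_edge_row_edge_row[OF assms(1) \<open>a \<in> V\<close> \<open>b \<in> V\<close>]
      by (intro allI impI) simp
  qed
  then show ?thesis unfolding gram_in_def by auto
qed

lemma resid_poly:
  assumes F: "F \<subseteq> ratpoly J" and R: "poly_rows I R J" and S: "\<And>s. s \<in> S \<Longrightarrow> comb F R s"
    and r: "\<And>i. i \<in> I \<Longrightarrow> (\<lambda>x. r x i) \<in> ratpoly J" and i: "i \<in> I"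
  shows "(\<lambda>x. resid I S r x i) \<in> ratpoly J"
proof -
  note ring = fun_ring_ratpoly[of J]
  have s: "(\<lambda>x. s x j) \<in> ratpoly J" if sj: "s \<in> S" "j \<in> I" for s j
  proof -
    obtain c where c: "\<forall>r\<in>R. c r \<in> F" "s = (\<lambda>x i. \<Sum>r\<in>R. c r x * r x i)"
      using S[OF sj(1)] by (auto simp: comb_def)
    have "(\<lambda>x. c r x * r x j) \<in> ratpoly J" if "r \<in> R" for r
      using c(1) F R sj(2) that unfolding poly_rows_def by (intro fun_ringD(5)[OF ring]) blast+
    then show ?thesis unfolding c(2) by (rule fun_ring_sum[OF ring])
  qed
  have n: "(\<lambda>x. nrms I T x) \<in> ratpoly J" if "T \<subseteq> S" for T
    unfolding nrms_def using that by (intro fun_ring_prod[OF ring] fun_ring_ip[OF ring] s) auto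
  show ?thesis unfolding resid_def
    by (intro fun_ringD(4,5)[OF ring] fun_ring_sum[OF ring] fun_ring_ip[OF ring] n s r i) auto
qed

text \<open>Linear dependence at a generic point persists: the residual of \<open>r\<close> vanishes
  at \<open>x\<close>, its entries are rational polynomials, so it vanishes identically. Where
  \<open>nrms\<close> is nonzero, \<open>r q\<close> is therefore in the span of \<open>S\<close> at
  \<open>q\<close>.\<close>

lemma resid_generic:
  assumes S: "gs_system F I R x Q S" and F: "F \<subseteq> ratpoly J" and R: "poly_rows I R J" and I: "finite I"
    and r: "\<And>i. i \<in> I \<Longrightarrow> (\<lambda>x. r x i) \<in> ratpoly J" and x: "alg_independent_over_rat J x"
    and span: "\<forall>v. (\<forall>s\<in>S. ip I v (s x) = 0) \<longrightarrow> ip I v (r x) = 0"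
    and q: "nrms I S q \<noteq> 0" "\<forall>s\<in>S. ip I v (s q) = 0"
  shows "ip I v (r q) = 0"
proof -
  have "resid I S r x i = 0" if "i \<in> I" for i
    by (rule resid_eq_0[OF I gs_systemD(1,3)[OF S] _ that]) (use span in blast)
  moreover have "(\<lambda>q. resid I S r q i) \<in> ratpoly J" if "i \<in> I" for i
    using resid_poly[of F J I R S r i, OF F R gs_systemD(2)[OF S] r that] .
  ultimately have "resid I S r q i = 0" if "i \<in> I" for i
    using generic_zero[of J x "\<lambda>q. resid I S r q i" q, OF x] that by simp
  then have "ip I (resid I S r q) v = 0" by (simp add: ip_def)
  moreover have "ip I (resid I S r q) v = nrms I S q * ip I (r q) v"
    by (rule ip_resid_orth) (use q(2) in \<open>simp add: ip_commute\<close>)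
  ultimately show ?thesis using q(1) by (simp only: ip_commute) simp
qed

text \<open>\<open>S\<close> is an orthogonal basis of the row space of \<open>P\<close> at a
  generic point, with coefficients that are distance-invariant polynomials.\<close>

locale generic_framework =
  fixes V :: "'v set" and P :: "('v \<times> 'v) set" and x :: "'v \<times> 'd::finite \<Rightarrow> real" and S
  assumes V: "finite V" and P: "P \<subseteq> V \<times> V"
    and x: "alg_independent_over_rat (V \<times> UNIV) x"
    and S: "gs_system (ratpoly (V \<times> UNIV) \<inter> dist_invariant V) (V \<times> UNIV) (edge_rows P) x
        (edge_rows P) S"
begin

abbreviation "I \<equiv> V \<times> (UNIV :: 'd set)"

lemma fin: "finite I"
  using V by simp

lemma edge_row_poly: "a \<in> V \<Longrightarrow> b \<in> V \<Longrightarrow> i \<in> I \<Longrightarrow> (\<lambda>q. edge_row a b q i) \<in> ratpoly I"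
  using poly_rows_edge_rows[of "{(a, b)}" V V] unfolding poly_rows_def by auto

text \<open>Together with \<open>P_imp_S\<close>: where \<open>nrms\<close> is nonzero,
  \<open>S\<close> and the edge rows have the same orthogonal complement.\<close>

lemma S_imp_P:
  assumes "nrms I S q \<noteq> 0" "\<forall>s\<in>S. ip I v (s q) = 0" "(a, b) \<in> P"
  shows "ip I v (edge_row a b q) = 0"
proof (rule resid_generic[OF S Int_lower1 poly_rows_edge_rows[OF P] fin _ x _ assms(1,2)])
  have ab: "a \<in> V" "b \<in> V" using assms(3) P by auto
  show "(\<lambda>q. edge_row a b q i) \<in> ratpoly I" if "i \<in> I" for i
    by (rule edge_row_poly[OF ab that])
  have "edge_row a b \<in> edge_rows P" using assms(3) by force
  then show "\<forall>v. (\<forall>s\<in>S. ip I v (s x) = 0) \<longrightarrow> ip I v (edge_row a b x) = 0"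
    using S unfolding gs_system_def by blast
qed

lemma P_imp_S:
  assumes "\<forall>(a, b)\<in>P. ip I v (edge_row a b q) = 0"
  shows "\<forall>s\<in>S. ip I v (s q) = 0"
proof
  fix s assume "s \<in> S"
  then show "ip I v (s q) = 0" by (rule gs_orth[OF S]) (use assms in auto)
qed

text \<open>Infinitesimal rigidity at \<open>x\<close> puts every edge row in the span of
  \<open>S\<close>, and \<open>resid_generic\<close> carries this dependence to
  \<open>q\<close>.\<close>

lemma inf_rigid_open:
  assumes "inf_rigid V P x" "nrms I S q \<noteq> 0"
  shows "inf_rigid V P q"
  unfolding inf_rigid_def
proof (intro allI impI ballI)
  fix w a b assume w: "\<forall>(a, b)\<in>P. ip I w (edge_row a b q) = 0" and ab: "a \<in> V" "b \<in> V"
  show "ip I w (edge_row a b q) = 0"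
  proof (rule resid_generic[OF S Int_lower1 poly_rows_edge_rows[OF P] fin edge_row_poly[OF ab] x _
      assms(2)])
    show "\<forall>v. (\<forall>s\<in>S. ip I v (s x) = 0) \<longrightarrow> ip I v (edge_row a b x) = 0"
    proof (intro allI impI)
      fix v assume v: "\<forall>s\<in>S. ip I v (s x) = 0"
      have "nrms I S x \<noteq> 0" by (rule gs_systemD(4)[OF S])
      then have "\<forall>(a, b)\<in>P. ip I v (edge_row a b x) = 0" using S_imp_P[OF _ v] by blast
      then show "ip I v (edge_row a b x) = 0" using assms(1) ab unfolding inf_rigid_def by blast
    qed
    show "\<forall>s\<in>S. ip I w (s q) = 0" by (rule P_imp_S[OF w])
  qed
qed

lemma nrms_poly: "nrms I S \<in> ratpoly I" and nrms_invariant: "nrms I S \<in> dist_invariant V"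
proof -
  have "nrms I S \<in> ratpoly I \<inter> dist_invariant V"
    by (rule nrms_in[OF fun_ring_dist_invariant gram_in_dist_invariant[OF V P] gs_systemD(2)[OF S]])
  then show "nrms I S \<in> ratpoly I" "nrms I S \<in> dist_invariant V" by auto
qed

end

lemma generic_framework_exists:
  fixes x :: "'v \<times> 'd::finite \<Rightarrow> real"
  assumes "finite V" "P \<subseteq> V \<times> V" "alg_independent_over_rat (V \<times> UNIV) x"
  shows "\<exists>S. generic_framework V P x S"
proof -
  have "finite (edge_rows P)" using assms(1,2) by (simp add: finite_subset)
  moreover have "finite (V \<times> (UNIV :: 'd set))" using assms(1) by simp
  ultimately obtain S where
    "gs_system (ratpoly (V \<times> UNIV) \<inter> dist_invariant V) (V \<times> UNIV) (edge_rows P) x (edge_rows P) S"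
    using gs_exists_subset[OF fun_ring_dist_invariant gram_in_dist_invariant[OF assms(1,2)] _
        subset_refl]
    by blast
  with assms have "generic_framework V P x S" by unfold_locales
  then show ?thesis by (rule exI[of _ S])
qed

section \<open>Rigidity and infinitesimal rigidity\<close>

definition conf :: "('v \<Rightarrow> real ^ 'd) \<Rightarrow> 'v \<times> 'd \<Rightarrow> real" where
  "conf p = (\<lambda>(v, k). p v $ k)"

lemma conf_apply: "conf p (v, k) = p v $ k"
  by (simp add: conf_def)

lemma generic_on_conf: "generic_on V (p :: 'v \<Rightarrow> real ^ 'd)
    \<longleftrightarrow> alg_independent_over_rat (V \<times> (UNIV :: 'd set)) (conf p)"
  unfolding generic_on_def conf_def ..

lemma dist_eq_sqd: "dist (p u) (p v) = sqrt (sqd (conf p) u v)"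
  by (simp add: dist_vec_def L2_set_def dist_real_def sqd_def conf_apply)

lemma dist_eq_iff_sqd: "dist (p u) (p v) = dist (q u) (q v) \<longleftrightarrow> sqd (conf p) u v = sqd (conf q) u v"
  by (simp add: dist_eq_sqd)

definition edge_pairs :: "'v ugraph \<Rightarrow> ('v \<times> 'v) set" where
  "edge_pairs G = {(u, v). {u, v} \<in> uedges G}"

lemma edge_pairs_subset: "finite_simple_graph G \<Longrightarrow> edge_pairs G \<subseteq> uverts G \<times> uverts G"
  unfolding finite_simple_graph_def edge_pairs_def by auto

text \<open>A difference of two configurations is an infinitesimal motion of their midpoint exactly when
  it preserves lengths. This replaces differentiation along motions in both directions below.\<close>

lemma ip_diff_edge_row_midpoint:
  fixes y z :: "'v \<times> 'd::finite \<Rightarrow> real"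
  assumes "finite V" "u \<in> V" "v \<in> V"
  shows "ip (V \<times> UNIV) (\<lambda>i. y i - z i) (edge_row u v (\<lambda>i. (y i + z i) / 2))
      = (sqd y u v - sqd z u v) / 2"
proof -
  have "ip (V \<times> UNIV) (edge_row u v (\<lambda>i. (y i + z i) / 2)) (\<lambda>i. y i - z i)
      = (\<Sum>k\<in>UNIV. ((y (u, k) - y (v, k))\<^sup>2 - (z (u, k) - z (v, k))\<^sup>2) / 2)"
    unfolding ip_edge_row[OF assms]
    by (intro sum.cong refl) (simp add: field_simps power2_eq_square)
  also have "\<dots> = (sqd y u v - sqd z u v) / 2"
    unfolding sqd_def sum_divide_distrib[symmetric] sum_subtractf ..
  finally show ?thesis by (simp only: ip_commute)
qed

text \<open>The times \<open>T0\<close> at which all distances have their initial values form a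
  clopen subset of the interval. For openness, \<open>y t - y t0\<close> is an infinitesimal motion
  of the midpoint of \<open>y t\<close> and \<open>y t0\<close>; for \<open>t\<close> near
  \<open>t0\<close> this midpoint is infinitesimally rigid, so all distances agree.\<close>

lemma inf_rigid_imp_rigid:
  fixes p :: "'v \<Rightarrow> real ^ 'd::finite"
  assumes G: "finite_simple_graph G" and p: "generic_on (uverts G) p"
    and rig: "inf_rigid (uverts G) (edge_pairs G) (conf p)"
  shows "rigid G p"
  unfolding rigid_def
proof (intro allI impI)
  fix q assume q: "motion G p q"
  define V where "V = uverts G"
  define P where "P = edge_pairs G"
  define x where "x = conf p"
  define y where "y t = conf (q t)" for t
  have V: "finite V" using G by (simp add: finite_simple_graph_def V_def)
  have P: "P \<subseteq> V \<times> V" using edge_pairs_subset[OF G] by (simp add: V_def P_def)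
  have x: "alg_independent_over_rat (V \<times> UNIV) x" using p by (simp add: generic_on_conf V_def x_def)
  from generic_framework_exists[OF V P x] obtain S where "generic_framework V P x S" ..
  then interpret generic_framework V P x S .
  have y_cont: "continuous_on {0..1} (\<lambda>t. y t i)" if iI: "i \<in> I" for i
  proof -
    obtain v k where i: "i = (v, k)" "v \<in> uverts G" using iI by (auto simp: V_def)
    then have "continuous_on {0..1} (\<lambda>t. q t v)" using q by (simp add: motion_def)
    then show ?thesis
      unfolding i y_def conf_apply by (rule bounded_linear.continuous_on[OF bounded_linear_vec_nth])
  qed
  have edge: "sqd (y t) u v = sqd x u v" if "t \<in> {0..1}" "(u, v) \<in> P" for t u v
  proof -
    have "dist (q t u) (q t v) = dist (p u) (p v)"
      using q that unfolding motion_def P_def edge_pairs_def by blast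
    then show ?thesis by (simp only: dist_eq_iff_sqd x_def y_def)
  qed
  define T0 where "T0 = {t \<in> {0..1}. \<forall>u\<in>V. \<forall>v\<in>V. sqd (y t) u v = sqd x u v}"
  have sqd_cont: "continuous_on {0..1} (\<lambda>t. sqd (y t) u v)" if "u \<in> V" "v \<in> V" for u v
    unfolding sqd_def by (intro continuous_intros y_cont) (use that in auto)
  \<comment> \<open>A sum of squares encodes all the equations in one continuous function, which
    gives closedness.\<close>
  have "T0 = {t \<in> {0..1}. (\<Sum>u\<in>V. \<Sum>v\<in>V. (sqd (y t) u v - sqd x u v)\<^sup>2) = 0}"
    unfolding T0_def using V by (simp add: sum_nonneg_eq_0_iff sum_nonneg)
  moreover have "closedin (top_of_set {0..1}) {t \<in> {0..1}. (\<Sum>u\<in>V. \<Sum>v\<in>V. (sqd (y t) u v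
      - sqd x u v)\<^sup>2) = 0}"
    by (intro continuous_closedin_preimage_constant continuous_intros sqd_cont)
  ultimately have closed: "closedin (top_of_set {0..1}) T0" by simp
  have "openin (top_of_set {0..1}) T0"
  proof (subst openin_subopen, intro ballI)
    fix t0 assume t0: "t0 \<in> T0"
    define mid where "mid t = (\<lambda>i. (y t i + y t0 i) / 2)" for t
    define U where "U = {t \<in> {0..1}. nrms I S (mid t) \<in> - {0}}"
    have "continuous_on {0..1} (\<lambda>t. nrms I S (mid t))"
      by (rule ratpoly_continuous_on[OF nrms_poly]) (auto simp: mid_def intro!: continuous_intros
          y_cont)
    from continuous_openin_preimage_gen[OF this, of "- {0}"]
    have "openin (top_of_set {0..1}) ({0..1} \<inter> (\<lambda>t. nrms I S (mid t)) -` (- {0}))"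
        by (simp add: open_Compl)
    moreover have "U = {0..1} \<inter> (\<lambda>t. nrms I S (mid t)) -` (- {0})" by (auto simp: U_def)
    ultimately have "openin (top_of_set {0..1}) U" by simp
    moreover have "t0 \<in> U"
    proof -
      \<comment> \<open>\<open>y t0\<close> need not be generic, but it has the distances of
        \<open>x\<close>, and \<open>nrms\<close> depends only on those.\<close>
      have "nrms I S (y t0) = nrms I S x"
        using nrms_invariant t0 unfolding dist_invariant_def T0_def by blast
      moreover have "mid t0 = y t0" by (simp add: mid_def)
      ultimately show ?thesis using gs_systemD(4)[OF S] t0 by (simp add: U_def T0_def)
    qed
    moreover have "U \<subseteq> T0"
    proof
      fix t assume t: "t \<in> U"
      then have t1: "t \<in> {0..1}" and nz: "nrms I S (mid t) \<noteq> 0" by (auto simp: U_def)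
      have mid_rig: "inf_rigid V P (mid t)"
        by (rule inf_rigid_open[OF rig[folded V_def P_def x_def] nz])
      have mid_eq: "ip I (\<lambda>i. y t i - y t0 i) (edge_row u v (mid t))
          = (sqd (y t) u v - sqd (y t0) u v) / 2"
        if "u \<in> V" "v \<in> V" for u v
        unfolding mid_def by (rule ip_diff_edge_row_midpoint[OF V that])
      have "ip I (\<lambda>i. y t i - y t0 i) (edge_row u v (mid t)) = 0" if "(u, v) \<in> P" for u v
      proof -
        have "u \<in> V" "v \<in> V" using that P by auto
        then show ?thesis using edge[OF t1 that] edge[OF _ that, of t0] t0
            by (simp add: mid_eq T0_def)
      qed
      then have "ip I (\<lambda>i. y t i - y t0 i) (edge_row u v (mid t)) = 0" if "u \<in> V" "v \<in> V" for u v
        using mid_rig that unfolding inf_rigid_def by blast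
      then have "sqd (y t) u v = sqd (y t0) u v" if "u \<in> V" "v \<in> V" for u v
        using mid_eq[OF that] that by simp
      then show "t \<in> T0" using t0 t1 by (simp add: T0_def)
    qed
    ultimately show "\<exists>U. openin (top_of_set {0..1}) U \<and> t0 \<in> U \<and> U \<subseteq> T0" by blast
  qed
  with closed have "T0 = {} \<or> T0 = {0..1}"
    using connected_clopen[of "{0..1::real}"] connected_Icc by blast
  moreover have "0 \<in> T0"
  proof -
    have "sqd (y 0) u v = sqd x u v" if "u \<in> V" "v \<in> V" for u v
      using q that unfolding motion_def sqd_def y_def x_def V_def by (simp add: conf_apply)
    then show ?thesis by (simp add: T0_def)
  qed
  ultimately have T0: "T0 = {0..1}" by blast
  show "\<forall>t\<in>{0..1}. \<forall>u\<in>uverts G. \<forall>v\<in>uverts G. dist (q t u) (q t v) = dist (p u) (p v)"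
  proof (intro ballI)
    fix t u v assume "t \<in> {0..1::real}" "u \<in> uverts G" "v \<in> uverts G"
    then have "sqd (y t) u v = sqd x u v" using T0 unfolding T0_def V_def by blast
    then show "dist (q t u) (q t v) = dist (p u) (p v)" by (simp only: dist_eq_iff_sqd x_def y_def)
  qed
qed

lemma ratpoly_cong:
  assumes "f \<in> ratpoly I" "\<And>i. i \<in> I \<Longrightarrow> x i = y i"
  shows "f x = f y"
  using assms(1) by induction (simp_all add: assms(2))

text \<open>If infinitesimal rigidity fails at the pair \<open>a b\<close>, a polynomial field of
  infinitesimal motions yields an exact flex that changes the length of \<open>a b\<close>.\<close>

lemma rigid_imp_inf_rigid:
  fixes p :: "'v \<Rightarrow> real ^ 'd::finite"
  assumes G: "finite_simple_graph G" and p: "generic_on (uverts G) p" and rig: "rigid G p"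
  shows "inf_rigid (uverts G) (edge_pairs G) (conf p)"
proof (rule ccontr)
  assume not_rig: "\<not> inf_rigid (uverts G) (edge_pairs G) (conf p)"
  define V where "V = uverts G"
  define P where "P = edge_pairs G"
  define x where "x = conf p"
  have V: "finite V" using G by (simp add: finite_simple_graph_def V_def)
  have P: "P \<subseteq> V \<times> V" using edge_pairs_subset[OF G] by (simp add: V_def P_def)
  have x: "alg_independent_over_rat (V \<times> UNIV) x" using p by (simp add: generic_on_conf V_def x_def)
  from generic_framework_exists[OF V P x] obtain S where "generic_framework V P x S" ..
  then interpret generic_framework V P x S .
  have "\<not> inf_rigid V P x" using not_rig by (simp add: V_def P_def x_def)
  then obtain w a b where w: "\<forall>(a, b)\<in>P. ip I w (edge_row a b x) = 0" and ab: "a \<in> V" "b \<in> V"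
    and wab: "ip I w (edge_row a b x) \<noteq> 0" unfolding inf_rigid_def by blast
  \<comment> \<open>Removing from the row of \<open>a b\<close> its components along the rows of
    \<open>P\<close> leaves, where \<open>nrms\<close> is nonzero, an infinitesimal motion depending
    polynomially on the configuration.\<close>
  define X where "X = resid I S (edge_row a b)"
  have X_poly: "(\<lambda>q. X q i) \<in> ratpoly I" if "i \<in> I" for i
    unfolding X_def
    by (rule resid_poly[OF Int_lower1 poly_rows_edge_rows[OF P] gs_systemD(2)[OF S]
        edge_row_poly[OF ab] that])
  have X_orth: "ip I (X q) (edge_row c d q) = 0" if "nrms I S q \<noteq> 0" "(c, d) \<in> P" for q c d
  proof (rule S_imp_P[OF that(1) _ that(2)])
    show "\<forall>s\<in>S. ip I (X q) (s q) = 0"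
      unfolding X_def using ip_resid_member[OF gs_systemD(1,3)[OF S]] by blast
  qed
  \<comment> \<open>Half the rate at which \<open>X\<close> changes the squared length of
    \<open>a b\<close>. By \<open>ip_resid_self\<close> it is nonzero at \<open>x\<close> because
    \<open>X x\<close> is.\<close>
  define h where "h q = ip I (edge_row a b q) (X q)" for q
  have h_poly: "h \<in> ratpoly I"
    unfolding h_def[abs_def]
    by (intro fun_ring_ip[OF fun_ring_ratpoly] X_poly edge_row_poly[OF ab])
  have "ip I (X x) w = nrms I S x * ip I (edge_row a b x) w"
    unfolding X_def by (rule ip_resid_orth) (use P_imp_S[OF w] in \<open>simp add: ip_commute\<close>)
  then have "ip I (X x) w \<noteq> 0"
    using wab gs_systemD(4)[OF S] by (simp add: ip_commute)
  then have "\<not> (\<forall>i\<in>I. X x i = 0)" unfolding ip_def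
      by (metis (no_types, lifting) mult_zero_left sum.neutral)
  then have "ip I (X x) (X x) \<noteq> 0" by (simp add: ip_self_eq_0_iff[OF fin])
  then have hx: "h x \<noteq> 0"
    unfolding h_def X_def ip_resid_self[OF gs_systemD(1,3)[OF S]] by simp
  obtain \<delta> m where \<delta>: "\<delta> > 0" and m_cont: "\<And>i. i \<in> I \<Longrightarrow> continuous_on {0..\<delta>} (\<lambda>s. m s i)"
    and m: "\<And>s i. s \<in> {0..\<delta>} \<Longrightarrow> i \<in> I \<Longrightarrow> m s i = x i + s * X (m s) i"
    using implicit_curve[of I X x, OF fin X_poly] by blast
  have m0: "m 0 i = x i" if "i \<in> I" for i using m[of 0 i] that \<delta> by simp
  \<comment> \<open>Nonvanishing of \<open>g\<close> secures at once that \<open>X\<close> is an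
    infinitesimal motion and that it changes the length of \<open>a b\<close>.\<close>
  define g where "g q = nrms I S q * h q" for q
  have g_poly: "g \<in> ratpoly I" unfolding g_def[abs_def] by (intro ratpoly.mult nrms_poly h_poly)
  have g0: "g (m 0) \<noteq> 0"
    using ratpoly_cong[OF g_poly m0] hx gs_systemD(4)[OF S] by (simp add: g_def)
  define U where "U = {s \<in> {0..\<delta>}. g (m s) \<in> - {0}}"
  have "continuous_on {0..\<delta>} (\<lambda>s. g (m s))" by (rule ratpoly_continuous_on[OF g_poly m_cont])
  from continuous_openin_preimage_gen[OF this, of "- {0}"]
  have "openin (top_of_set {0..\<delta>}) ({0..\<delta>} \<inter> (\<lambda>s. g (m s)) -` (- {0}))" by (simp add: open_Compl)
  moreover have "U = {0..\<delta>} \<inter> (\<lambda>s. g (m s)) -` (- {0})" by (auto simp: U_def)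
  ultimately have "openin (top_of_set {0..\<delta>}) U" by simp
  moreover have "0 \<in> U" using g0 \<delta> by (simp add: U_def)
  ultimately obtain e where e: "e > 0" "cball 0 e \<inter> {0..\<delta>} \<subseteq> U"
    unfolding openin_contains_cball by blast
  define \<epsilon> where "\<epsilon> = min e \<delta>"
  have \<epsilon>: "\<epsilon> > 0" using e \<delta> by (simp add: \<epsilon>_def)
  have s_ok: "s \<in> {0..\<delta>}" "nrms I S (m s) \<noteq> 0" "h (m s) \<noteq> 0" if "s \<in> {0..\<epsilon>}" for s
  proof -
    have "s \<in> cball 0 e \<inter> {0..\<delta>}" using that by (simp add: \<epsilon>_def)
    then have "s \<in> U" using e(2) by blast
    then show "s \<in> {0..\<delta>}" "nrms I S (m s) \<noteq> 0" "h (m s) \<noteq> 0" by (auto simp: U_def g_def)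
  qed
  \<comment> \<open>The reflection of \<open>x\<close> in the point \<open>m\<close>, so that
    \<open>m\<close> is the midpoint of \<open>q\<close> and \<open>x\<close> and the midpoint
    identity applies.\<close>
  define q where "q t = (\<lambda>v. \<chi> k. 2 * m (\<epsilon> * t) (v, k) - x (v, k))" for t
  have t_ok: "\<epsilon> * t \<in> {0..\<epsilon>}" if "t \<in> {0..1}" for t using that \<epsilon> by (simp add: mult_left_le)
  have sqd_q: "sqd (conf (q t)) u v - sqd x u v
      = 4 * (\<epsilon> * t) * ip I (X (m (\<epsilon> * t))) (edge_row u v (m (\<epsilon> * t)))"
    if t: "t \<in> {0..1}" and uv: "u \<in> V" "v \<in> V" for t u v
  proof -
    define s where "s = \<epsilon> * t"
    have s: "s \<in> {0..\<delta>}" unfolding s_def by (rule s_ok(1)[OF t_ok[OF t]])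
    have mid: "(\<lambda>i. (conf (q t) i + x i) / 2) = m s"
      by (rule ext) (auto simp: q_def conf_def s_def)
    have "(sqd (conf (q t)) u v - sqd x u v) / 2 = ip I (\<lambda>i. conf (q t) i - x i) (edge_row u v (m s))"
      unfolding ip_diff_edge_row_midpoint[OF V uv, symmetric] mid ..
    also have "\<dots> = ip I (\<lambda>i. (2 * s) * X (m s) i) (edge_row u v (m s))"
    proof (rule ip_cong)
      fix i assume i: "i \<in> I"
      have "conf (q t) i - x i = 2 * (m s i - x i)" by (cases i) (simp add: q_def conf_apply s_def)
      also have "\<dots> = 2 * s * X (m s) i" using m[OF s i] by simp
      finally show "conf (q t) i - x i = 2 * s * X (m s) i" .
    qed simp
    also have "\<dots> = 2 * s * ip I (X (m s)) (edge_row u v (m s))" by (rule ip_scale_left)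
    finally show ?thesis by (simp add: s_def)
  qed
  have "motion G p q"
    unfolding motion_def
  proof (intro conjI ballI allI impI)
    fix v assume v: "v \<in> uverts G"
    have "continuous_on {0..1} (\<lambda>t. m (\<epsilon> * t) (v, k))" for k
    proof (rule continuous_on_compose2[OF m_cont])
      show "(v, k) \<in> I" using v by (simp add: V_def)
      show "continuous_on {0..1} (\<lambda>t. \<epsilon> * t)" by (intro continuous_intros)
      show "(\<lambda>t. \<epsilon> * t) ` {0..1} \<subseteq> {0..\<delta>}" using s_ok(1)[OF t_ok] by blast
    qed
    then show "continuous_on {0..1} (\<lambda>t. q t v)"
      unfolding q_def by (intro continuous_on_vec_lambda continuous_intros)
    show "q 0 v = p v"
      using v m0 by (simp add: q_def vec_eq_iff V_def x_def conf_apply)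
  next
    fix t u v assume t: "t \<in> {0..1::real}" and "{u, v} \<in> uedges G"
    then have uv: "(u, v) \<in> P" by (simp add: P_def edge_pairs_def)
    then have "u \<in> V" "v \<in> V" using P by auto
    then have "sqd (conf (q t)) u v - sqd x u v = 0"
      using sqd_q[OF t] X_orth[OF s_ok(2)[OF t_ok[OF t]] uv] by simp
    then have "sqd (conf (q t)) u v = sqd (conf p) u v" by (simp add: x_def)
    then show "dist (q t u) (q t v) = dist (p u) (p v)" by (simp only: dist_eq_iff_sqd)
  qed
  then have "dist (q 1 a) (q 1 b) = dist (p a) (p b)"
    using rig ab unfolding rigid_def V_def by (meson atLeastAtMost_iff order_refl zero_le_one)
  then have "sqd (conf (q 1)) a b - sqd x a b = 0" by (simp add: dist_eq_iff_sqd x_def)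
  moreover have "sqd (conf (q 1)) a b - sqd x a b = 4 * \<epsilon> * h (m \<epsilon>)"
    using sqd_q[of 1, OF _ ab] by (simp add: h_def ip_commute)
  ultimately show False using s_ok(3)[of \<epsilon>] \<epsilon> by simp
qed

section \<open>Collapsing the parts\<close>

text \<open>Limit directions of edges after the collapse: between distinct parts the difference of
  their points, inside a part the direction of its line, stored at index
  \<open>m + i\<close>.\<close>

definition part_dir :: "nat \<Rightarrow> (nat \<times> 'd \<Rightarrow> real) \<Rightarrow> nat \<Rightarrow> nat \<Rightarrow> 'd \<Rightarrow> real" where
  "part_dir m x i j k = (if i = j then x (m + i, k) else x (i, k) - x (j, k))"

text \<open>\<open>CARD('d)\<close> of these directions are linearly independent at a generic
  \<open>x\<close>, since they are so for a special choice.\<close>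

lemma part_dir_span:
  fixes x :: "nat \<times> 'd::finite \<Rightarrow> real"
  assumes x: "alg_independent_over_rat ({1..2 * m} \<times> UNIV) x"
    and i: "i \<in> {1..m}" and J: "J \<subseteq> {1..m}" "card J = CARD('d)"
    and y: "\<And>j. j \<in> J \<Longrightarrow> (\<Sum>k\<in>UNIV. part_dir m x i j k * y k) = 0"
  shows "y k = 0"
proof -
  define R where "R = (\<lambda>j (x :: nat \<times> 'd \<Rightarrow> real). part_dir m x i j) ` J"
  have finJ: "finite J" using J(1) finite_subset by blast
  obtain \<phi> where \<phi>: "bij_betw \<phi> J (UNIV :: 'd set)"
    using finite_same_card_bij[OF finJ finite, of "UNIV :: 'd set"] J(2) by auto
  \<comment> \<open>The point of \<open>i\<close> is at the origin, the other points of
    \<open>J\<close> at negated basis vectors and the line direction at a basis vector, so the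
    directions become the standard basis.\<close>
  define x0 :: "nat \<times> 'd \<Rightarrow> real" where
    "x0 = (\<lambda>(v, k). if v = m + i then (if k = \<phi> i then 1 else 0)
       else if v \<in> J - {i} \<and> k = \<phi> v then -1 else 0)"
  have dir0: "part_dir m x0 i j = (\<lambda>k. if k = \<phi> j then 1 else 0)" if "j \<in> J" for j
  proof
    fix k
    have "j \<noteq> m + i" "i \<noteq> m + i" using i J(1) that by auto
    then show "part_dir m x0 i j k = (if k = \<phi> j then 1 else 0)"
      using that by (simp add: part_dir_def x0_def)
  qed
  have "ker_zero UNIV R x0"
    unfolding ker_zero_def
  proof (intro allI impI ballI)
    fix v :: "'d \<Rightarrow> real" and k
    assume v: "\<forall>r\<in>R. ip UNIV v (r x0) = 0"
    obtain j where j: "j \<in> J" "k = \<phi> j" using \<phi> by (metis UNIV_I bij_betw_imp_surj_on imageE)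
    then have "(\<lambda>x. part_dir m x i j) \<in> R" by (simp add: R_def)
    then have "ip UNIV v (part_dir m x0 i j) = 0" using bspec[OF v] by fastforce
    then have "ip UNIV (\<lambda>k. if k = \<phi> j then 1 else 0) v = 0" by (simp only: dir0[OF j(1)] ip_commute)
    then show "v k = 0" by (simp add: ip_unit j(2))
  qed
  moreover have "poly_rows UNIV R ({1..2 * m} \<times> UNIV)"
    unfolding poly_rows_def
  proof (intro ballI)
    fix r and k :: 'd assume "r \<in> R"
    then obtain j where j: "j \<in> J" "r = (\<lambda>x. part_dir m x i j)" by (auto simp: R_def)
    then have "i \<in> {1..2 * m}" "j \<in> {1..2 * m}" "m + i \<in> {1..2 * m}" using i J(1) by auto
    then show "(\<lambda>x. r x k) \<in> ratpoly ({1..2 * m} \<times> UNIV)"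
      unfolding j part_dir_def by (cases "i = j") (auto intro!: fun_ringD[OF fun_ring_ratpoly]
          ratpoly.var)
  qed
  moreover have "finite R" using finJ by (simp add: R_def)
  ultimately have "ker_zero UNIV R x" using ker_zero_generic x finite by blast
  moreover have "\<forall>r\<in>R. ip UNIV y (r x) = 0"
    using y by (simp add: R_def ip_def mult.commute)
  ultimately show ?thesis unfolding ker_zero_def by blast
qed

lemma edge_pairs_reduced_graph:
  assumes "(i, j) \<in> edge_pairs (reduced_graph G Vs m)"
  obtains u v where "i \<in> {1..m}" "j \<in> {1..m}" "i \<noteq> j" "u \<in> Vs i" "v \<in> Vs j" "(u, v) \<in> edge_pairs G"
proof -
  obtain a b u v where ab: "{i, j} = {a, b}" "a \<in> {1..m}" "b \<in> {1..m}" "a \<noteq> b" "u \<in> Vs a"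
      "v \<in> Vs b" "{u, v} \<in> uedges G"
    using assms unfolding edge_pairs_def reduced_graph_def by auto
  then consider "i = a" "j = b" | "i = b" "j = a" by (auto simp: doubleton_eq_iff)
  then show thesis
  proof cases
    case 1
    then show ?thesis using ab by (intro that[of u v]) (auto simp: edge_pairs_def)
  next
    case 2
    then show ?thesis using ab by (intro that[of v u]) (auto simp: edge_pairs_def insert_commute)
  qed
qed

lemma finite_simple_graph_reduced_graph: "finite_simple_graph (reduced_graph G Vs m)"
  unfolding finite_simple_graph_def reduced_graph_def by auto

lemma fun_ring_continuous: "fun_ring {f :: real \<Rightarrow> real. continuous_on UNIV f}"
  unfolding fun_ring_def by (auto intro: continuous_intros)

text \<open>The points of the part \<open>Vs i\<close> are placed on the line through \<open>x i\<close> in the direction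
  \<open>x (m + i)\<close>, at distances proportional to \<open>\<epsilon>\<close>.\<close>

locale rigid_partition =
  fixes G :: "'a ugraph" and Vs :: "nat \<Rightarrow> 'a set" and m :: nat and x :: "nat \<times> 'd::finite \<Rightarrow> real"
  assumes G: "finite_simple_graph G"
    and nonempty: "i \<in> {1..m} \<Longrightarrow> Vs i \<noteq> {}"
    and disjoint: "disjoint_family_on Vs {1..m}"
    and cover: "(\<Union>i\<in>{1..m}. Vs i) = uverts G"
    and components: "i \<in> {1..m} \<Longrightarrow> u \<in> Vs i \<Longrightarrow> v \<in> Vs i \<Longrightarrow> u \<noteq> v \<Longrightarrow>
        CARD('d) \<le> card {j \<in> {1..m}. same_component (edges_between_graph G (Vs i) (Vs j)) u v}"
    and x: "alg_independent_over_rat ({1..2 * m} \<times> UNIV) x"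
    and ker: "ker_zero ({1..m} \<times> UNIV) (edge_rows (edge_pairs (reduced_graph G Vs m)) \<union>
        trivial_rows) x"
begin

abbreviation "V \<equiv> uverts G"
abbreviation "I \<equiv> V \<times> (UNIV :: 'd set)"
abbreviation "P \<equiv> edge_pairs G"

definition part :: "'a \<Rightarrow> nat" where
  "part v = (SOME i. i \<in> {1..m} \<and> v \<in> Vs i)"

lemma finV: "finite V" and PV: "P \<subseteq> V \<times> V"
  using G edge_pairs_subset[OF G] by (auto simp: finite_simple_graph_def)

lemma part: "v \<in> V \<Longrightarrow> part v \<in> {1..m} \<and> v \<in> Vs (part v)"
  unfolding part_def by (rule someI_ex) (use cover in blast)

lemma part_eq: "i \<in> {1..m} \<Longrightarrow> v \<in> Vs i \<Longrightarrow> part v = i"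
  using part[of v] cover disjoint unfolding disjoint_family_on_def by blast

definition coll :: "('a \<Rightarrow> real) \<Rightarrow> real \<Rightarrow> 'a \<times> 'd \<Rightarrow> real" where
  "coll c \<epsilon> = (\<lambda>(v, k). x (part v, k) + \<epsilon> * c v * x (m + part v, k))"

text \<open>Inside a part, the edge row is divided by \<open>\<epsilon> (c u - c v)\<close>, which keeps its limit nonzero.\<close>

definition limit_row :: "('a \<Rightarrow> real) \<Rightarrow> 'a \<Rightarrow> 'a \<Rightarrow> real \<Rightarrow> 'a \<times> 'd \<Rightarrow> real" where
  "limit_row c u v \<epsilon> = (if part u = part v
     then (\<lambda>(w, k). ((if w = u then 1 else 0) - (if w = v then 1 else 0)) * x (m + part u, k))
     else edge_row u v (coll c \<epsilon>))"

definition limit_rows :: "('a \<Rightarrow> real) \<Rightarrow> (real \<Rightarrow> 'a \<times> 'd \<Rightarrow> real) set" where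
  "limit_rows c = (\<lambda>(u, v). limit_row c u v) ` P \<union> range (\<lambda>j \<epsilon>. trivial_row j (coll c \<epsilon>))"

text \<open>The two kinds of limit rows become uniform at 0, which is why \<open>part_dir\<close>
  joins both cases.\<close>

lemma ip_limit_row_0:
  assumes "u \<in> V" "v \<in> V"
  shows "ip I w (limit_row c u v 0) = (\<Sum>k\<in>UNIV. part_dir m x (part u) (part v) k * (w (u, k)
      - w (v, k)))"
proof (cases "part u = part v")
  case True
  then show ?thesis
    unfolding limit_row_def part_dir_def ip_commute[of I w] using ip_diff_row[OF finV assms] by simp
next
  case False
  then show ?thesis
    unfolding limit_row_def part_dir_def ip_commute[of I w]
        by (simp add: ip_edge_row[OF finV assms] coll_def)
qed

text \<open>Along a path in \<open>G[V_i,V_j]\<close> the velocity stays constant in the direction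
  \<open>part_dir m x i j\<close>. With enough independent directions it is constant on parts and
  descends to the reduced graph, where \<open>ker\<close> makes it trivial. Hence \<open>w\<close>
  is trivial and orthogonal to all trivial rows.\<close>

lemma ker_zero_limit: "ker_zero I (limit_rows c) 0"
  unfolding ker_zero_def
proof (intro allI impI)
  fix w assume w: "\<forall>r\<in>limit_rows c. ip I w (r 0) = 0"
  let ?d = "part_dir m x"
  have edge: "(\<Sum>k\<in>UNIV. ?d (part u) (part v) k * (w (u, k) - w (v, k))) = 0" if "(u, v) \<in> P" for u v
  proof -
    have "u \<in> V" "v \<in> V" using that PV by auto
    moreover have "limit_row c u v \<in> limit_rows c" using that by (auto simp: limit_rows_def)
    ultimately show ?thesis using ip_limit_row_0[of u v w c] w by simp
  qed
  have edge_step: "(\<Sum>k\<in>UNIV. ?d i j k * (w (a, k) - w (b, k))) = 0"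
    if ij: "i \<in> {1..m}" "j \<in> {1..m}" and ab: "{a, b} \<in> uedges (edges_between_graph G (Vs i) (Vs
        j))" for i j a b
  proof -
    have E: "{a, b} \<in> uedges G" "{a, b} \<inter> Vs i \<noteq> {}" "{a, b} \<inter> Vs j \<noteq> {}" "{a, b} \<subseteq> Vs i \<union> Vs j"
      using ab by (auto simp: edges_between_graph_def)
    have p: "(a, b) \<in> P" using E(1) by (simp add: edge_pairs_def)
    \<comment> \<open>If \<open>i = j\<close> only the first case arises; otherwise the edge joins
      the two parts, and the reversed orientation changes the sign of the direction.\<close>
    consider "part a = i" "part b = j" | "i \<noteq> j" "part a = j" "part b = i"
      using E(2-4) part_eq[OF ij(1)] part_eq[OF ij(2)] by blast
    then show ?thesis
    proof cases
      case 1
      then show ?thesis using edge[OF p] by simp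
    next
      case 2
      have "(\<Sum>k\<in>UNIV. ?d i j k * (w (a, k) - w (b, k)))
          = - (\<Sum>k\<in>UNIV. ?d j i k * (w (a, k) - w (b, k)))"
        unfolding sum_negf[symmetric] by (intro sum.cong refl) (use 2(1) in \<open>simp add:
            part_dir_def algebra_simps\<close>)
      then show ?thesis using edge[OF p] 2 by simp
    qed
  qed
  have comp: "(\<Sum>k\<in>UNIV. ?d i j k * (w (u, k) - w (v, k))) = 0"
    if ij: "i \<in> {1..m}" "j \<in> {1..m}" and "same_component (edges_between_graph G (Vs i) (Vs j)) u
        v" for i j u v
  proof -
    have "(u, v) \<in> {(a, b). {a, b} \<in> uedges (edges_between_graph G (Vs i) (Vs j))}\<^sup>*"
      using that(3) unfolding same_component_def by (elim conjE)
    then show ?thesis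
    proof induction
      case base
      show ?case by simp
    next
      case (step b e)
      have "(\<Sum>k\<in>UNIV. ?d i j k * (w (u, k) - w (e, k)))
          = (\<Sum>k\<in>UNIV. ?d i j k * (w (u, k) - w (b, k))) + (\<Sum>k\<in>UNIV. ?d i j k * (w (b, k) - w (e, k)))"
        unfolding sum.distrib[symmetric] by (intro sum.cong refl) (simp add: algebra_simps)
      also have "(\<Sum>k\<in>UNIV. ?d i j k * (w (b, k) - w (e, k))) = 0"
        by (rule edge_step[OF ij]) (use step.hyps(2) in simp)
      finally show ?case using step.IH by simp
    qed
  qed
  have const: "w (u, k) = w (v, k)" if i: "i \<in> {1..m}" and uv: "u \<in> Vs i" "v \<in> Vs i" for i u v k
  proof (cases "u = v")
    case False
    \<comment> \<open>\<open>J\<close> may contain \<open>i\<close> itself, in which case the line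
      direction of the part is among the directions.\<close>
    obtain J where J: "J \<subseteq> {j \<in> {1..m}. same_component (edges_between_graph G (Vs i) (Vs j)) u v}"
        "card J = CARD('d)"
      by (rule obtain_subset_with_card_n[OF components[OF i uv False]])
    have "w (u, k) - w (v, k) = 0"
    proof (rule part_dir_span[OF x i _ J(2), where y = "\<lambda>k. w (u, k) - w (v, k)"])
      show "J \<subseteq> {1..m}" using J(1) by blast
      show "(\<Sum>k\<in>UNIV. ?d i j k * (w (u, k) - w (v, k))) = 0" if "j \<in> J" for j
        using J(1) that by (intro comp[OF i]) auto
    qed
    then show ?thesis by simp
  qed simp
  \<comment> \<open>The induced velocities on the reduced graph; by \<open>const\<close> the chosen
    representative does not matter.\<close>
  define w' where "w' = (\<lambda>(i, k :: 'd). w (SOME v. v \<in> Vs i, k))"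
  have w': "w' (i, k) = w (v, k)" if "i \<in> {1..m}" "v \<in> Vs i" for i v k
    unfolding w'_def using const[OF that(1) _ that(2)] someI[of "\<lambda>v. v \<in> Vs i", OF that(2)] by simp
  have "\<forall>(i, j)\<in>edge_pairs (reduced_graph G Vs m). ip ({1..m} \<times> UNIV) w' (edge_row i j x) = 0"
  proof (intro ballI, clarify)
    fix i j assume "(i, j) \<in> edge_pairs (reduced_graph G Vs m)"
    then obtain u v where ij: "i \<in> {1..m}" "j \<in> {1..m}" "i \<noteq> j" and uv: "u \<in> Vs i" "v \<in> Vs j"
        "(u, v) \<in> P"
      by (rule edge_pairs_reduced_graph)
    have "ip ({1..m} \<times> UNIV) (edge_row i j x) w'
        = (\<Sum>k\<in>UNIV. (x (i, k) - x (j, k)) * (w (u, k) - w (v, k)))"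
      using ij uv by (subst ip_edge_row) (simp_all add: w')
    also have "\<dots> = 0"
      using edge[OF uv(3)] ij(3) by (simp add: part_dir_def part_eq[OF ij(1) uv(1)] part_eq[OF
          ij(2) uv(2)])
    finally show "ip ({1..m} \<times> UNIV) w' (edge_row i j x) = 0" by (simp only: ip_commute)
  qed
  from motion_trivial[OF _ _ ker this] obtain t
    where t: "\<forall>i\<in>{1..m} \<times> UNIV. w' i = (\<Sum>j\<in>UNIV. t j * trivial_row j x i)"
    using edge_pairs_subset[OF finite_simple_graph_reduced_graph, of G Vs m]
        by (auto simp: reduced_graph_def)
  \<comment> \<open>At 0 each vertex sits at the point of its part, so trivial motions of the
    reduced graph lift to trivial motions of \<open>G\<close>.\<close>
  have t_coll: "trivial_row j x (part v, k) = trivial_row j (coll c 0) (v, k)" for j v k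
    by (cases "(j, x, part v, k)" rule: trivial_row.cases) (simp_all add: coll_def)
  have w_eq: "w i = (\<Sum>j\<in>UNIV. t j * trivial_row j (coll c 0) i)" if iI: "i \<in> I" for i
  proof -
    obtain v k where i: "i = (v, k)" "v \<in> V" using iI by auto
    have "w i = w' (part v, k)" by (simp only: i(1) w'[OF part[OF i(2), THEN conjunct1] part[OF
        i(2), THEN conjunct2]])
    also have "\<dots> = (\<Sum>j\<in>UNIV. t j * trivial_row j x (part v, k))"
      using t part[OF i(2)] by blast
    finally show ?thesis by (simp only: t_coll i(1))
  qed
  have "ip I w w = ip I w (\<lambda>i. \<Sum>j\<in>UNIV. t j * trivial_row j (coll c 0) i)"
    by (rule ip_cong) (simp_all add: w_eq)
  also have "\<dots> = 0"
    unfolding ip_comb_right using w by (auto simp: limit_rows_def intro!: sum.neutral)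
  finally show "\<forall>i\<in>I. w i = 0" using finV by (simp add: ip_self_eq_0_iff)
qed

lemma limit_row_scale:
  "part u = part v \<Longrightarrow> edge_row u v (coll c \<epsilon>) i = \<epsilon> * (c u - c v) * limit_row c u v \<epsilon> i"
  by (cases i) (simp add: edge_row_def limit_row_def coll_def algebra_simps)

lemma gram_in_limit_rows: "gram_in {f. continuous_on UNIV f} I (limit_rows c)"
proof -
  have coll: "continuous_on UNIV (\<lambda>\<epsilon>. coll c \<epsilon> i)" for i
    unfolding coll_def by (cases i) (auto intro!: continuous_intros)
  have coll_if: "continuous_on UNIV (\<lambda>\<epsilon>. if b then coll c \<epsilon> i else 0)" for b i
    using coll by (cases b) auto
  have row_cont: "continuous_on UNIV (\<lambda>\<epsilon>. limit_row c u v \<epsilon> i)" for u v i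
    by (cases "part u = part v"; cases i) (auto simp: limit_row_def edge_row_def intro!:
        continuous_intros coll)
  have triv_cont: "continuous_on UNIV (\<lambda>\<epsilon>. trivial_row j (coll c \<epsilon>) i)" for j i
    by (cases "(j, coll c 0, i)" rule: trivial_row.cases) (auto intro!: continuous_intros coll_if)
  have "continuous_on UNIV (\<lambda>\<epsilon>. r \<epsilon> i)" if r: "r \<in> limit_rows c" for r i
  proof -
    from r consider u v where "r = limit_row c u v" | j where "r = (\<lambda>\<epsilon>. trivial_row j (coll c \<epsilon>))"
      by (auto simp: limit_rows_def)
    then show ?thesis by cases (simp_all only: row_cont triv_cont)
  qed
  then show ?thesis
    unfolding gram_in_def by (intro ballI fun_ring_ip[OF fun_ring_continuous]) auto
qed

text \<open>Full rank spreads from the limit at 0 to a small nonzero \<open>\<epsilon>\<close> by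
  continuity, where limit rows and edge rows differ by nonzero factors, and from that placement to
  every generic one.\<close>

lemma ker_zero_generic_placement:
  assumes z: "alg_independent_over_rat I z"
  shows "ker_zero I (edge_rows P \<union> trivial_rows) z"
proof -
  \<comment> \<open>An injective labelling keeps the vertices of a part at distinct parameters along
    its line.\<close>
  obtain f :: "'a \<Rightarrow> nat" where "inj_on f V"
    using finite_imp_inj_to_nat_seg[OF finV] by blast
  define c where "c v = real (f v)" for v
  have c: "c u \<noteq> c v" if "u \<in> V" "v \<in> V" "u \<noteq> v" for u v
    using \<open>inj_on f V\<close> that by (auto simp: c_def dest: inj_onD)
  have finP: "finite P" using PV finV by (simp add: finite_subset)
  have "finite (limit_rows c)" using finP by (simp add: limit_rows_def)
  from ker_zero_open[OF fun_ring_continuous gram_in_limit_rows this _ ker_zero_limit]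
  obtain N :: "real \<Rightarrow> real" where N: "continuous_on UNIV N" "N 0 \<noteq> 0"
    "\<forall>\<epsilon>. N \<epsilon> \<noteq> 0 \<longrightarrow> ker_zero I (limit_rows c) \<epsilon>" using finV by auto
  \<comment> \<open>The rescaling of rows inside a part divides by \<open>\<epsilon>\<close>, so a
    nonzero value near 0 is needed.\<close>
  have "isCont N 0" using N(1) by (simp add: continuous_on_eq_continuous_at)
  then have "\<forall>\<^sub>F \<epsilon> in at 0. N \<epsilon> \<noteq> 0" using N(2) by (simp add: isCont_def tendsto_imp_eventually_ne)
  then obtain d where d: "d > 0" "\<forall>\<epsilon>\<in>UNIV. \<epsilon> \<noteq> 0 \<and> dist \<epsilon> 0 < d \<longrightarrow> N \<epsilon> \<noteq> 0"
    unfolding eventually_at by blast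
  define \<epsilon> where "\<epsilon> = d / 2"
  have \<epsilon>: "N \<epsilon> \<noteq> 0" "\<epsilon> \<noteq> 0" using d by (simp_all add: \<epsilon>_def dist_real_def)
  have K: "ker_zero I (limit_rows c) \<epsilon>" using N(3) \<epsilon>(1) by blast
  have "ker_zero I (edge_rows P \<union> trivial_rows) (coll c \<epsilon>)"
    unfolding ker_zero_def
  proof (intro allI impI)
    fix w assume w: "\<forall>r\<in>edge_rows P \<union> trivial_rows. ip I w (r (coll c \<epsilon>)) = 0"
    have "ip I w (limit_row c u v \<epsilon>) = 0" if uv: "(u, v) \<in> P" for u v
    proof -
      have "edge_row u v \<in> edge_rows P \<union> trivial_rows" using uv by auto
      from bspec[OF w this] have e: "ip I (edge_row u v (coll c \<epsilon>)) w = 0"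
        by (simp only: ip_commute)
      have "ip I (limit_row c u v \<epsilon>) w = 0"
      proof (cases "part u = part v")
        case True
        have "u \<in> V" "v \<in> V" "u \<noteq> v"
          using uv PV G by (auto simp: edge_pairs_def finite_simple_graph_def)
        then have "\<epsilon> * (c u - c v) \<noteq> 0" using c \<epsilon>(2) by simp
        moreover have "\<epsilon> * (c u - c v) * ip I (limit_row c u v \<epsilon>) w = 0"
          using e unfolding ip_scale_left[symmetric] limit_row_scale[OF True, symmetric] by simp
        ultimately show ?thesis by simp
      next
        case False
        then show ?thesis using e by (simp add: limit_row_def)
      qed
      then show ?thesis by (simp only: ip_commute)
    qed
    then have "\<forall>r\<in>limit_rows c. ip I w (r \<epsilon>) = 0" using w by (auto simp: limit_rows_def)
    then show "\<forall>i\<in>I. w i = 0" using K unfolding ker_zero_def by blast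
  qed
  from ker_zero_generic[OF _ _ _ this z] show ?thesis
    using finP finV by (simp add: poly_rows_Un poly_rows_edge_rows[OF PV] poly_rows_trivial_rows)
qed

lemma d_rigid_graph: "d_rigid TYPE('d) G"
proof -
  obtain z where z: "alg_independent_over_rat I z"
    using alg_independent_exists[of I] finV by auto
  define p :: "'a \<Rightarrow> real ^ 'd" where "p v = (\<chi> k. z (v, k))" for v
  have pz: "conf p = z" by (auto simp: conf_def p_def)
  have gen: "generic_on V p" using z by (simp add: generic_on_conf pz)
  have "inf_rigid V P (conf p)"
    unfolding pz by (rule ker_zero_imp_inf_rigid[OF finV PV ker_zero_generic_placement[OF z]])
  then have "rigid G p" by (rule inf_rigid_imp_rigid[OF G gen])
  then show ?thesis using gen unfolding d_rigid_def by blast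
qed

end

theorem theorem1p6:
  fixes G :: "'a ugraph" and Vs :: "nat \<Rightarrow> 'a set" and m :: nat
  assumes "finite_simple_graph G"
    and "CARD('d::finite) \<le> m"
    and "\<And>i. i \<in> {1..m} \<Longrightarrow> Vs i \<noteq> {}"
    and "disjoint_family_on Vs {1..m}"
    and "(\<Union>i\<in>{1..m}. Vs i) = uverts G"
    and "d_rigid TYPE('d) (reduced_graph G Vs m)"
    and "\<And>i u v. i \<in> {1..m} \<Longrightarrow> u \<in> Vs i \<Longrightarrow> v \<in> Vs i \<Longrightarrow> u \<noteq> v \<Longrightarrow>
           CARD('d) \<le> card {j \<in> {1..m}. same_component (edges_between_graph G (Vs i) (Vs j)) u v}"
  shows "d_rigid TYPE('d) G"
proof -
  let ?H = "reduced_graph G Vs m" and ?W = "{1..m}"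
  let ?J = "?W \<times> (UNIV :: 'd set)"
  have H: "finite_simple_graph ?H" by (rule finite_simple_graph_reduced_graph)
  have W: "uverts ?H = ?W" by (simp add: reduced_graph_def)
  have PW: "edge_pairs ?H \<subseteq> ?W \<times> ?W" using edge_pairs_subset[OF H] by (simp add: W)
  obtain p :: "nat \<Rightarrow> real ^ 'd" where p: "generic_on ?W p" "rigid ?H p"
    using assms(6) by (auto simp: d_rigid_def W)
  have rig: "inf_rigid ?W (edge_pairs ?H) (conf p)"
    using rigid_imp_inf_rigid[OF H _ p(2)] p(1) by (simp add: W)
  \<comment> \<open>Here \<open>m\<close> supplies enough vertices for
    \<open>complete_ker_zero_generic\<close>.\<close>
  have compl: "ker_zero ?J (edge_rows (?W \<times> ?W) \<union> trivial_rows) (conf p)"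
    by (rule complete_ker_zero_generic) (use assms(2) p(1) in \<open>simp_all add: generic_on_conf\<close>)
  \<comment> \<open>Infinitesimal rigidity upgrades orthogonality to the rows of the reduced graph
    to orthogonality to the rows of all pairs.\<close>
  have ker_p: "ker_zero ?J (edge_rows (edge_pairs ?H) \<union> trivial_rows) (conf p)"
    unfolding ker_zero_def
  proof (intro allI impI)
    fix w assume w: "\<forall>r\<in>edge_rows (edge_pairs ?H) \<union> trivial_rows. ip ?J w (r (conf p)) = 0"
    then have "\<forall>(a, b)\<in>edge_pairs ?H. ip ?J w (edge_row a b (conf p)) = 0" by auto
    then have "\<forall>a\<in>?W. \<forall>b\<in>?W. ip ?J w (edge_row a b (conf p)) = 0"
      using rig unfolding inf_rigid_def by blast
    then have "\<forall>r\<in>edge_rows (?W \<times> ?W) \<union> trivial_rows. ip ?J w (r (conf p)) = 0"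
      using w by auto
    then show "\<forall>i\<in>?J. w i = 0" using compl unfolding ker_zero_def by blast
  qed
  \<comment> \<open>A fresh generic family with twice as many points: the first \<open>m\<close>
    place the parts, the others give the line directions. Full rank passes from \<open>p\<close> to
    the first half.\<close>
  obtain x :: "nat \<times> 'd \<Rightarrow> real" where x: "alg_independent_over_rat ({1..2 * m} \<times> UNIV) x"
    using alg_independent_exists[of "{1..2 * m} \<times> (UNIV :: 'd set)"] by auto
  have "alg_independent_over_rat ?J x"
    by (rule alg_independent_over_rat_subset[OF x]) auto
  from ker_zero_generic[OF poly_rows_Un[OF poly_rows_edge_rows[OF PW] poly_rows_trivial_rows] _ _
      ker_p this]
  have "ker_zero ?J (edge_rows (edge_pairs ?H) \<union> trivial_rows) x"
    using finite_subset[OF PW] by simp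
  then interpret rigid_partition G Vs m x
    using assms x by unfold_locales auto
  show ?thesis by (rule d_rigid_graph)
qed

end
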